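(* Let $D$ be a double poset on a finite set $N$ and let $\mathfrak{G}\subseteq\operatorname{Aut}(D)$. Then $\Omega(D,\mathfrak{G},\mathbf{x})$ is $M$-increasing and $\Omega(D,\mathfrak{G},x)$ is effectively flawless. Let $G$ be a digraph on $N$ and let $\mathfrak{H}\subseteq\operatorname{Aut}(G)$. For every $k\in\mathbb{N}$, $[t^k]\chi(G,\mathfrak{H},t,\mathbf{x})$ is $M$-increasing and $[t^k]\chi(G,\mathfrak{H},t,x)$ is effectively flawless.
   Context: Double poset: $D=(N,\le_1,\le_2)$, two partial orders on $N$; $\operatorname{Aut}(D)$ = bijections preserving both orders. A $D$-partition is $f:N\to\{1,2,\dots\}$ with $i\le_1 j\Rightarrow f(i)\le f(j)$ and ($i<_1 j$ and $j<_2 i$) $\Rightarrow f(i)<f(j)$. $\Omega(D,\mathfrak{G},\mathbf{x};\mathfrak{g})=\sum_f\prod_{v}x_{f(v)}$ over $D$-partitions with $f\circ\mathfrak{g}=f$; for a positive integer $n$, $\Omega(D,\mathfrak{G},n;\mathfrak{g})$ is the number of such $f$ with values in $\{1,\dots,n\}$, and $\Omega(D,\mathfrak{G},x)$ is the class function with values in $\mathbb{C}[x]$ agreeing with this at all positive integers. Digraph: at most one directed edge between two vertices; a coloring is $f:N\to\{1,2,\dots\}$ with $f(u)\neq f(v)$ for each edge $(u,v)$; $\operatorname{asc}(f)$ = number of edges $(u,v)$ with $f(u)>f(v)$; $\operatorname{Aut}(G)$ = bijections of $N$ preserving the edge set. $\chi(G,\mathfrak{H},t,\mathbf{x};\mathfrak{g})=\sum_f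 t^{\operatorname{asc}(f)}\prod_v x_{f(v)}$ over colorings with $f\circ\mathfrak{g}=f$, and $\chi(G,\mathfrak{H},t,x)$ is the polynomial class function whose value at a positive integer $n$ is the same sum restricted to colorings with values in $\{1,\dots,n\}$; $[t^k]$ extracts the coefficient of $t^k$. Compositions are ordered by refinement ($\alpha\le\beta$ iff $\beta$ refines $\alpha$); $M_\alpha$ are the monomial quasisymmetric functions. For characters $\chi,\psi$ of $\mathfrak{G}$, $\chi\le_{\mathfrak{G}}\psi$ means $\psi-\chi$ is an effective character (nonnegative integer combination of irreducible characters). A $\mathrm{QSym}$-valued class function $\chi$ is $M$-increasing if $[M_\beta]\chi-[M_\alpha]\chi$ is an effective character whenever $\alpha\le\beta$. A class function $p$ with values in polynomials of degree $d$ (here $d=|N|$) is written $p=\sum_{i=0}^d f_i\binom{x}{i}$ with class functions $f_i$ (its equivariant $f$-vector); $p$ is effectively flawless if $f_i\le_{\mathfrak{G}}f_{i+1}$ for $0\le i\le\frac{d-1}2$ and $f_i\le_{\mathfrak{G}}f_{d-i}$ for $0\le i\le\frac d2$. *)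

theory Defs
  imports
    "HOL-Algebra.Bij"
    "HOL-Library.Poly_Mapping"
    "HOL-Computational_Algebra.Polynomial"
    "Jordan_Normal_Form.VS_Connect"
begin

section \<open>Complex characters of a group\<close>

definition mat_trace :: "complex mat \<Rightarrow> complex" where
  "mat_trace A = (\<Sum>i<dim_row A. A $$ (i, i))"

definition general_linear_group :: "nat \<Rightarrow> complex mat monoid" where
  "general_linear_group n = units_of (ring_mat TYPE(complex) n ())"

definition irreducible_rep ::
  "('g, 'b) monoid_scheme \<Rightarrow> nat \<Rightarrow> ('g \<Rightarrow> complex mat) \<Rightarrow> bool" where
  "irreducible_rep G n \<rho> \<longleftrightarrow>
     0 < n \<and> \<rho> \<in> hom G (general_linear_group n) \<and>
     (\<forall>W. subspace class_ring W (module_vec TYPE(complex) n) \<and>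
          (\<forall>g\<in>carrier G. \<forall>w\<in>W. \<rho> g *\<^sub>v w \<in> W)
        \<longrightarrow> W = {0\<^sub>v n} \<or> W = carrier_vec n)"

definition irreducible_characters ::
  "('g, 'b) monoid_scheme \<Rightarrow> ('g \<Rightarrow> complex) set" where
  "irreducible_characters G =
     {\<lambda>g\<in>carrier G. mat_trace (\<rho> g) | n \<rho>. irreducible_rep G n \<rho>}"

definition effective_character ::
  "('g, 'b) monoid_scheme \<Rightarrow> ('g \<Rightarrow> complex) \<Rightarrow> bool" where
  "effective_character G \<phi> \<longleftrightarrow>
     (\<exists>I m. finite I \<and> I \<subseteq> irreducible_characters G \<and>
        (\<forall>g\<in>carrier G. \<phi> g = (\<Sum>\<psi>\<in>I. of_nat (m \<psi>) * \<psi> g)))"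

definition character_le ::
  "('g, 'b) monoid_scheme \<Rightarrow> ('g \<Rightarrow> complex) \<Rightarrow> ('g \<Rightarrow> complex) \<Rightarrow> bool" where
  "character_le G \<phi> \<psi> \<longleftrightarrow> effective_character G (\<lambda>g. \<psi> g - \<phi> g)"

definition class_function :: "('g, 'b) monoid_scheme \<Rightarrow> ('g \<Rightarrow> 'c) \<Rightarrow> bool" where
  "class_function G F \<longleftrightarrow>
     (\<forall>g\<in>carrier G. \<forall>h\<in>carrier G. F (h \<otimes>\<^bsub>G\<^esub> g \<otimes>\<^bsub>G\<^esub> inv\<^bsub>G\<^esub> h) = F g)"

section \<open>Quasisymmetric functions\<close>

text \<open>
  A monomial in the variables \<open>x\<^sub>1, x\<^sub>2, \<dots>\<close> is given by its finitely supported exponent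
  function, and a formal power series by its coefficient function. The index 0 never occurs in
  the monomials used below.
\<close>

type_synonym 'c series = "(nat \<Rightarrow>\<^sub>0 nat) \<Rightarrow> 'c"

text \<open>
  \<open>formal_sum A w \<mu>\<close> is the power series \<open>\<Sum>a\<in>A. w a * x ^ \<mu> a\<close>. It is meaningful only if every
  monomial is \<open>\<mu> a\<close> for finitely many \<open>a \<in> A\<close>, which is the case in all uses below.
\<close>

definition formal_sum ::
  "'i set \<Rightarrow> ('i \<Rightarrow> 'c::comm_monoid_add) \<Rightarrow> ('i \<Rightarrow> (nat \<Rightarrow>\<^sub>0 nat)) \<Rightarrow> 'c series" where
  "formal_sum A w \<mu> = (\<lambda>m. \<Sum>a\<in>{a\<in>A. \<mu> a = m}. w a)"

definition compositions :: "nat list set" where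
  "compositions = {\<alpha>. 0 \<notin> set \<alpha>}"

text \<open>
  \<open>refined_by \<alpha> \<beta>\<close> is \<open>\<alpha> \<le> \<beta>\<close>: the composition \<open>\<beta>\<close> arises by splitting every part of \<open>\<alpha>\<close> into
  consecutive parts.
\<close>

definition refined_by :: "nat list \<Rightarrow> nat list \<Rightarrow> bool" where
  "refined_by \<alpha> \<beta> \<longleftrightarrow> (\<exists>\<gamma>. \<alpha> = map sum_list \<gamma> \<and> \<beta> = concat \<gamma>)"

definition monomial_qsym :: "nat list \<Rightarrow> complex series" where
  "monomial_qsym \<alpha> =
     formal_sum {js. length js = length \<alpha> \<and> sorted_wrt (<) js \<and> 0 \<notin> set js}
       (\<lambda>_. 1)
       (\<lambda>js. \<Sum>j<length \<alpha>. Poly_Mapping.single (js ! j) (\<alpha> ! j))"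

definition M_combination :: "(nat list \<Rightarrow>\<^sub>0 complex) \<Rightarrow> complex series" where
  "M_combination c =
     (\<lambda>m. \<Sum>\<alpha>\<in>Poly_Mapping.keys c. Poly_Mapping.lookup c \<alpha> * monomial_qsym \<alpha> m)"

definition QSym :: "complex series set" where
  "QSym = M_combination ` {c. Poly_Mapping.keys c \<subseteq> compositions}"

text \<open>\<open>M_coeff \<alpha> F\<close> is \<open>[M\<^sub>\<alpha>] F\<close>; see \<open>M_coeff_M_combination\<close> for well-definedness.\<close>

definition M_coeff :: "nat list \<Rightarrow> complex series \<Rightarrow> complex" where
  "M_coeff \<alpha> F =
     Poly_Mapping.lookup
       (the_inv_into {c. Poly_Mapping.keys c \<subseteq> compositions} M_combination F) \<alpha>"

lemma lookup_sum_single_nth: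
  fixes js \<alpha> :: "nat list"
  assumes "distinct js" "length js = length \<alpha>" "k < length \<alpha>"
  shows "Poly_Mapping.lookup (\<Sum>j<length \<alpha>. Poly_Mapping.single (js ! j) (\<alpha> ! j)) (js ! k) = \<alpha> ! k"
proof -
  have "Poly_Mapping.lookup (\<Sum>j<length \<alpha>. Poly_Mapping.single (js ! j) (\<alpha> ! j)) (js ! k)
      = (\<Sum>j<length \<alpha>. if j = k then \<alpha> ! j else 0)"
    unfolding lookup_sum
    by (rule sum.cong) (use assms in \<open>auto simp: lookup_single when_def nth_eq_iff_index_eq\<close>)
  then show ?thesis
    using assms by simp
qed

lemma keys_sum_single_nth:
  fixes js \<alpha> :: "nat list"
  assumes "distinct js" "length js = length \<alpha>" "0 \<notin> set \<alpha>"
  shows "Poly_Mapping.keys (\<Sum>j<length \<alpha>. Poly_Mapping.single (js ! j) (\<alpha> ! j)) = set js"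
    (is "Poly_Mapping.keys ?s = _")
proof
  show "Poly_Mapping.keys ?s \<subseteq> set js"
  proof
    fix x assume "x \<in> Poly_Mapping.keys ?s"
    then have "(\<Sum>j<length \<alpha>. Poly_Mapping.lookup (Poly_Mapping.single (js ! j) (\<alpha> ! j)) x) \<noteq> 0"
      by (simp add: in_keys_iff lookup_sum)
    then obtain j where "j < length \<alpha>" "Poly_Mapping.lookup (Poly_Mapping.single (js ! j) (\<alpha> ! j)) x \<noteq> 0"
      by (meson lessThan_iff sum.neutral)
    then show "x \<in> set js"
      using assms by (auto simp: lookup_single when_def split: if_splits)
  qed
  show "set js \<subseteq> Poly_Mapping.keys ?s"
  proof
    fix x assume "x \<in> set js"
    then obtain k where k: "k < length \<alpha>" "x = js ! k"
      using assms by (metis in_set_conv_nth)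
    then have "\<alpha> ! k \<noteq> 0"
      using assms by (metis nth_mem)
    then show "x \<in> Poly_Mapping.keys ?s"
      using lookup_sum_single_nth[of js \<alpha> k] assms k by (simp add: in_keys_iff)
  qed
qed

lemma monomial_qsym_leading:
  assumes "\<alpha> \<in> compositions" "\<beta> \<in> compositions"
  shows "monomial_qsym \<beta> (\<Sum>j<length \<alpha>. Poly_Mapping.single ([1..<Suc (length \<alpha>)] ! j) (\<alpha> ! j))
    = (if \<beta> = \<alpha> then 1 else 0)"
proof -
  let ?J = "[1..<Suc (length \<alpha>)]"
  let ?A = "{js. (length js = length \<beta> \<and> sorted_wrt (<) js \<and> 0 \<notin> set js) \<and>
      (\<Sum>j<length \<beta>. Poly_Mapping.single (js ! j) (\<beta> ! j))
        = (\<Sum>j<length \<alpha>. Poly_Mapping.single (?J ! j) (\<alpha> ! j))}"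
  have len: "length ?J = length \<alpha>" by (simp del: upt_Suc)
  have *: "js = ?J \<and> \<beta> = \<alpha>" if "js \<in> ?A" for js
  proof -
    have i: "length js = length \<beta>" "sorted_wrt (<) js" "0 \<notin> set js"
      and eq: "(\<Sum>j<length \<beta>. Poly_Mapping.single (js ! j) (\<beta> ! j))
        = (\<Sum>j<length \<alpha>. Poly_Mapping.single (?J ! j) (\<alpha> ! j))"
      using that by auto
    have d: "distinct js" using i(2) strict_sorted_iff by blast
    have "set js = set ?J"
      using keys_sum_single_nth[OF d i(1)] keys_sum_single_nth[OF distinct_upt len] eq assms
      by (simp add: compositions_def)
    then have iJ: "js = ?J"
      using i(2) by (intro strict_sorted_equal) (auto simp del: upt_Suc)
    then have l: "length \<beta> = length \<alpha>" using i(1) len by metis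
    have "\<beta> = \<alpha>"
    proof (rule nth_equalityI[OF l])
      fix k assume k: "k < length \<beta>"
      then show "\<beta> ! k = \<alpha> ! k"
        using lookup_sum_single_nth[OF d i(1) k] lookup_sum_single_nth[OF distinct_upt len, of k]
          eq l iJ by (simp del: upt_Suc)
    qed
    with iJ show ?thesis by simp
  qed
  have "card ?A = (if \<beta> = \<alpha> then 1 else 0)"
  proof (cases "\<beta> = \<alpha>")
    case True
    have "sorted_wrt (<) ?J" by (rule sorted_wrt_upt)
    then have "?J \<in> ?A" using True by (simp del: upt_Suc)
    then have "?A = {?J}" using * by blast
    then have "card ?A = 1" by (metis card_1_singleton_iff One_nat_def)
    then show ?thesis unfolding if_P[OF True] .
  next
    case False
    then have "?A = {}" using * by blast
    then have "card ?A = 0" by (simp only: card.empty)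
    then show ?thesis unfolding if_not_P[OF False] .
  qed
  then show ?thesis
    by (simp add: monomial_qsym_def formal_sum_def del: upt_Suc)
qed

lemma inj_on_M_combination: "inj_on M_combination {c. Poly_Mapping.keys c \<subseteq> compositions}"
proof -
  have *: "Poly_Mapping.lookup c \<alpha> = M_combination c
      (\<Sum>j<length \<alpha>. Poly_Mapping.single ([1..<Suc (length \<alpha>)] ! j) (\<alpha> ! j))"
    if "Poly_Mapping.keys c \<subseteq> compositions" "\<alpha> \<in> compositions" for c \<alpha>
  proof -
    have "M_combination c (\<Sum>j<length \<alpha>. Poly_Mapping.single ([1..<Suc (length \<alpha>)] ! j) (\<alpha> ! j))
      = (\<Sum>\<beta>\<in>Poly_Mapping.keys c. if \<beta> = \<alpha> then Poly_Mapping.lookup c \<beta> else 0)"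
      unfolding M_combination_def
      by (rule sum.cong) (use that monomial_qsym_leading in \<open>auto simp del: upt_Suc\<close>)
    then show ?thesis by (auto simp: in_keys_iff simp del: upt_Suc)
  qed
  show ?thesis
  proof (rule inj_onI)
    fix c c' assume c: "c \<in> {c. Poly_Mapping.keys c \<subseteq> compositions}"
      "c' \<in> {c. Poly_Mapping.keys c \<subseteq> compositions}" "M_combination c = M_combination c'"
    show "c = c'"
    proof (rule poly_mapping_eqI)
      fix \<alpha>
      show "Poly_Mapping.lookup c \<alpha> = Poly_Mapping.lookup c' \<alpha>"
      proof (cases "\<alpha> \<in> compositions")
        case True
        then show ?thesis using *[of c \<alpha>] *[of c' \<alpha>] c by simp
      next
        case False
        then have "\<alpha> \<notin> Poly_Mapping.keys c" "\<alpha> \<notin> Poly_Mapping.keys c'" using c by auto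
        then show ?thesis by (simp add: in_keys_iff)
      qed
    qed
  qed
qed

lemma M_coeff_M_combination:
  assumes "Poly_Mapping.keys c \<subseteq> compositions"
  shows "M_coeff \<alpha> (M_combination c) = Poly_Mapping.lookup c \<alpha>"
  using assms by (simp add: M_coeff_def the_inv_into_f_f[OF inj_on_M_combination])

definition M_increasing ::
  "('g, 'b) monoid_scheme \<Rightarrow> ('g \<Rightarrow> complex series) \<Rightarrow> bool" where
  "M_increasing G F \<longleftrightarrow>
     (\<forall>g\<in>carrier G. F g \<in> QSym) \<and> class_function G F \<and>
     (\<forall>\<alpha>\<in>compositions. \<forall>\<beta>\<in>compositions. refined_by \<alpha> \<beta> \<longrightarrow>
        effective_character G (\<lambda>g. M_coeff \<beta> (F g) - M_coeff \<alpha> (F g)))"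

section \<open>Effectively flawless polynomial class functions\<close>

definition binomial_poly :: "nat \<Rightarrow> complex poly" where
  "binomial_poly i = Polynomial.smult (1 / fact i) (\<Prod>j=0..<i. [:- of_nat j, 1:])"

lemma poly_binomial_poly: "poly (binomial_poly i) x = x gchoose i"
  by (simp add: binomial_poly_def gbinomial_prod_rev poly_prod)

text \<open>
  The argument \<open>d\<close> is the nominal degree; the leading coefficients may vanish. The polynomials
  \<open>binomial_poly i\<close> are linearly independent, so \<open>f\<close> is the equivariant f-vector of \<open>p\<close>. The range
  \<open>2 * i + 1 \<le> d\<close> is \<open>i \<le> (d - 1) / 2\<close>.
\<close>

definition effectively_flawless ::
  "('g, 'b) monoid_scheme \<Rightarrow> nat \<Rightarrow> ('g \<Rightarrow> complex poly) \<Rightarrow> bool" where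
  "effectively_flawless G d p \<longleftrightarrow>
     (\<exists>f :: nat \<Rightarrow> 'g \<Rightarrow> complex.
        (\<forall>i\<le>d. class_function G (f i)) \<and>
        (\<forall>g\<in>carrier G. p g = (\<Sum>i\<le>d. Polynomial.smult (f i g) (binomial_poly i))) \<and>
        (\<forall>i. 2 * i + 1 \<le> d \<longrightarrow> character_le G (f i) (f (i + 1))) \<and>
        (\<forall>i. 2 * i \<le> d \<longrightarrow> character_le G (f i) (f (d - i))))"

section \<open>Double posets and digraphs\<close>

text \<open>
  Functions on \<open>N\<close> are taken extensional, so that they are counted correctly.
\<close>

definition functions_fixed_by :: "'a set \<Rightarrow> ('a \<Rightarrow> 'a) \<Rightarrow> ('a \<Rightarrow> nat) set" where
  "functions_fixed_by N g = {f \<in> N \<rightarrow>\<^sub>E {1..}. \<forall>v\<in>N. f (g v) = f v}"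

definition function_monomial :: "'a set \<Rightarrow> ('a \<Rightarrow> nat) \<Rightarrow> nat \<Rightarrow>\<^sub>0 nat" where
  "function_monomial N f = (\<Sum>v\<in>N. Poly_Mapping.single (f v) 1)"

subsection \<open>Double posets\<close>

definition double_poset :: "'a set \<Rightarrow> 'a rel \<Rightarrow> 'a rel \<Rightarrow> bool" where
  "double_poset N r1 r2 \<longleftrightarrow> partial_order_on N r1 \<and> partial_order_on N r2"

text \<open>
  On a finite \<open>N\<close> a bijection that preserves a relation also reflects it, so the equivalences
  here and in \<open>digraph_Aut\<close> are no restriction there.
\<close>

definition double_poset_Aut :: "'a set \<Rightarrow> 'a rel \<Rightarrow> 'a rel \<Rightarrow> ('a \<Rightarrow> 'a) monoid" where
  "double_poset_Aut N r1 r2 = (BijGroup N)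
     \<lparr>carrier := {g \<in> Bij N. \<forall>i\<in>N. \<forall>j\<in>N.
        ((g i, g j) \<in> r1 \<longleftrightarrow> (i, j) \<in> r1) \<and> ((g i, g j) \<in> r2 \<longleftrightarrow> (i, j) \<in> r2)}\<rparr>"

definition D_partition :: "'a set \<Rightarrow> 'a rel \<Rightarrow> 'a rel \<Rightarrow> ('a \<Rightarrow> nat) \<Rightarrow> bool" where
  "D_partition N r1 r2 f \<longleftrightarrow>
     (\<forall>i\<in>N. \<forall>j\<in>N. (i, j) \<in> r1 \<longrightarrow> f i \<le> f j) \<and>
     (\<forall>i\<in>N. \<forall>j\<in>N. (i, j) \<in> r1 - Id \<and> (j, i) \<in> r2 - Id \<longrightarrow> f i < f j)"

definition Omega_series ::
  "'a set \<Rightarrow> 'a rel \<Rightarrow> 'a rel \<Rightarrow> ('a \<Rightarrow> 'a) \<Rightarrow> complex series" where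
  "Omega_series N r1 r2 g =
     formal_sum {f \<in> functions_fixed_by N g. D_partition N r1 r2 f}
       (\<lambda>_. 1) (function_monomial N)"

definition Omega_poly ::
  "'a set \<Rightarrow> 'a rel \<Rightarrow> 'a rel \<Rightarrow> ('a \<Rightarrow> 'a) \<Rightarrow> complex poly" where
  "Omega_poly N r1 r2 g = (THE p. \<forall>n::nat. 0 < n \<longrightarrow>
     poly p (of_nat n) =
       of_nat (card {f \<in> functions_fixed_by N g. D_partition N r1 r2 f \<and> f ` N \<subseteq> {1..n}}))"

subsection \<open>Digraphs\<close>

text \<open>
  At most one directed edge between two vertices: \<open>(u, v)\<close> and \<open>(v, u)\<close> are not both edges for
  \<open>u \<noteq> v\<close>. Loops are not excluded; a digraph with a loop has no coloring.
\<close>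

definition digraph :: "'a set \<Rightarrow> 'a rel \<Rightarrow> bool" where
  "digraph N E \<longleftrightarrow> E \<subseteq> N \<times> N \<and> antisym E"

definition digraph_Aut :: "'a set \<Rightarrow> 'a rel \<Rightarrow> ('a \<Rightarrow> 'a) monoid" where
  "digraph_Aut N E = (BijGroup N)
     \<lparr>carrier := {g \<in> Bij N. \<forall>u\<in>N. \<forall>v\<in>N. (g u, g v) \<in> E \<longleftrightarrow> (u, v) \<in> E}\<rparr>"

definition coloring :: "'a rel \<Rightarrow> ('a \<Rightarrow> nat) \<Rightarrow> bool" where
  "coloring E f \<longleftrightarrow> (\<forall>(u, v)\<in>E. f u \<noteq> f v)"

definition asc :: "'a rel \<Rightarrow> ('a \<Rightarrow> nat) \<Rightarrow> nat" where
  "asc E f = card {(u, v) \<in> E. f u > f v}"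

text \<open>
  The coefficient ring of the following series, and of the polynomial in \<open>x\<close> below, is the ring
  of polynomials in \<open>t\<close>; \<open>monom 1 k\<close> is \<open>t ^ k\<close>.
\<close>

definition chi_series ::
  "'a set \<Rightarrow> 'a rel \<Rightarrow> ('a \<Rightarrow> 'a) \<Rightarrow> complex poly series" where
  "chi_series N E g =
     formal_sum {f \<in> functions_fixed_by N g. coloring E f}
       (\<lambda>f. Polynomial.monom 1 (asc E f)) (function_monomial N)"

definition chi_poly ::
  "'a set \<Rightarrow> 'a rel \<Rightarrow> ('a \<Rightarrow> 'a) \<Rightarrow> complex poly poly" where
  "chi_poly N E g = (THE p. \<forall>n::nat. 0 < n \<longrightarrow>
     poly p (of_nat n) =
       (\<Sum>f\<in>{f \<in> functions_fixed_by N g. coloring E f \<and> f ` N \<subseteq> {1..n}}. Polynomial.monom 1 (asc E f)))"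

definition t_coeff_series :: "nat \<Rightarrow> complex poly series \<Rightarrow> complex series" where
  "t_coeff_series k F = (\<lambda>m. Polynomial.coeff (F m) k)"

definition t_coeff_poly :: "nat \<Rightarrow> complex poly poly \<Rightarrow> complex poly" where
  "t_coeff_poly k p = map_poly (\<lambda>c. Polynomial.coeff c k) p"

end

theory Submission
  imports Defs
begin

text \<open>
  Record the type of a surjection \<open>f\<close> onto \<open>{1..l}\<close> by the set \<open>S\<close> of numbers \<open>1 + |{u. f u < f v}|\<close>,
  a subset of \<open>{1..d}\<close>, where \<open>d = |N|\<close>; refinement of compositions becomes inclusion of these sets.
  The functions of type \<open>S\<close> are permuted by the group, and \<open>[M\<^sub>\<alpha>]\<close> of the series is the permutation
  character of the functions whose type belongs to \<open>\<alpha>\<close>. If \<open>S \<subseteq> T\<close>, then every admissible function of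
  type \<open>S\<close> arises by merging the values of one of type \<open>T\<close> (split the fibres along a linear extension).
  Merging is equivariant, so pulling back functions embeds one permutation representation into the
  other, and the difference of the characters is the character of the quotient.

  The f-vector entry \<open>f\<^sub>i\<close> is the sum of these characters over all \<open>S\<close> with \<open>i\<close> elements. A symmetric
  chain decomposition of the subsets of \<open>{1..d}\<close> matches the \<open>i\<close>-subsets injectively with \<open>j\<close>-subsets
  containing them whenever \<open>i \<le> j\<close> and \<open>i + j \<le> d\<close>, which gives both inequalities of flawlessness.
\<close>

section \<open>Matrix representations and effective characters\<close>

text \<open>Splitting and merging are not symmetric, and this shapes the proof. A splitting depends
  on a chosen linear extension, which a group element may fail to respect, so it yields no
  equivariant map from the coarse functions to the fine ones. It serves only to show that the
  equivariant merging map reaches every admissible function of the coarse type. Merging in turn can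
  destroy admissibility, since a strict inequality or a difference of colors may be lost. The map is
  therefore used on the invariant set of those fine functions whose merging is admissible; the
  remaining ones contribute a permutation character of their own, again effective. Effectiveness of
  any character of a matrix representation comes from additivity of the trace on block triangular
  matrices, by induction on the degree. All subsets of \<open>{1..d}\<close> count as types,
  although for \<open>d > 0\<close> only those containing 1 occur. The chains then live in the
  Boolean lattice of rank \<open>d\<close>, whose condition \<open>i + j \<le> d\<close> covers both
  kinds of inequality.\<close>

lemma effective_character_cong:
  assumes "effective_character G \<phi>" "\<And>g. g \<in> carrier G \<Longrightarrow> \<phi> g = \<psi> g"
  shows "effective_character G \<psi>"
  using assms unfolding effective_character_def by metis

lemma effective_character_zero: "effective_character G (\<lambda>_. 0)"
  unfolding effective_character_def by (rule exI[of _ "{}"]) auto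

lemma effective_character_add:
  assumes "effective_character G \<phi>" "effective_character G \<psi>"
  shows "effective_character G (\<lambda>g. \<phi> g + \<psi> g)"
proof -
  obtain I m where I: "finite I" "I \<subseteq> irreducible_characters G"
    and m: "\<forall>g\<in>carrier G. \<phi> g = (\<Sum>\<theta>\<in>I. of_nat (m \<theta>) * \<theta> g)"
    using assms(1) unfolding effective_character_def by metis
  obtain J k where J: "finite J" "J \<subseteq> irreducible_characters G"
    and k: "\<forall>g\<in>carrier G. \<psi> g = (\<Sum>\<theta>\<in>J. of_nat (k \<theta>) * \<theta> g)"
    using assms(2) unfolding effective_character_def by metis
  define l where "l \<theta> = (if \<theta> \<in> I then m \<theta> else 0) + (if \<theta> \<in> J then k \<theta> else 0)" for \<theta>
  have "\<phi> g + \<psi> g = (\<Sum>\<theta>\<in>I \<union> J. of_nat (l \<theta>) * \<theta> g)" if g: "g \<in> carrier G" for g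
  proof -
    have "(\<Sum>\<theta>\<in>I. of_nat (m \<theta>) * \<theta> g) = (\<Sum>\<theta>\<in>I \<union> J. of_nat (if \<theta> \<in> I then m \<theta> else 0) * \<theta> g)"
      using I J by (intro sum.mono_neutral_cong_left) auto
    moreover have "(\<Sum>\<theta>\<in>J. of_nat (k \<theta>) * \<theta> g) = (\<Sum>\<theta>\<in>I \<union> J. of_nat (if \<theta> \<in> J then k \<theta> else 0) * \<theta> g)"
      using I J by (intro sum.mono_neutral_cong_left) auto
    ultimately show ?thesis
      using m k g by (simp add: l_def distrib_right sum.distrib)
  qed
  then show ?thesis
    unfolding effective_character_def using I J by (intro exI[of _ "I \<union> J"] exI[of _ l]) auto
qed

lemma effective_character_sum:
  assumes "\<And>a. a \<in> A \<Longrightarrow> effective_character G (\<phi> a)"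
  shows "effective_character G (\<lambda>g. \<Sum>a\<in>A. \<phi> a g)"
  using assms
  by (induction A rule: infinite_finite_induct)
    (auto intro: effective_character_zero effective_character_add)

text \<open>Degree 0 is allowed, because the quotient of one permutation representation by another
  may be zero. For a group these conditions already force invertible values.\<close>

definition matrix_rep :: "('g, 'b) monoid_scheme \<Rightarrow> nat \<Rightarrow> ('g \<Rightarrow> complex mat) \<Rightarrow> bool" where
  "matrix_rep G n \<rho> \<longleftrightarrow>
     (\<forall>g\<in>carrier G. \<rho> g \<in> carrier_mat n n) \<and> \<rho> \<one>\<^bsub>G\<^esub> = 1\<^sub>m n \<and>
     (\<forall>g\<in>carrier G. \<forall>h\<in>carrier G. \<rho> (g \<otimes>\<^bsub>G\<^esub> h) = \<rho> g * \<rho> h)"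

lemma matrix_rep_in_hom:
  assumes "group G" "matrix_rep G n \<rho>"
  shows "\<rho> \<in> hom G (general_linear_group n)"
proof (rule homI)
  interpret group G by fact
  fix g assume g: "g \<in> carrier G"
  have "\<rho> g * \<rho> (inv\<^bsub>G\<^esub> g) = 1\<^sub>m n" "\<rho> (inv\<^bsub>G\<^esub> g) * \<rho> g = 1\<^sub>m n"
    using assms(2) g unfolding matrix_rep_def by (metis inv_closed r_inv l_inv)+
  then show "\<rho> g \<in> carrier (general_linear_group n)"
    using assms(2) g inv_closed[OF g]
    unfolding general_linear_group_def units_of_carrier Units_def matrix_rep_def
    by (auto simp: ring_mat_simps)
  fix h assume "h \<in> carrier G"
  then show "\<rho> (g \<otimes>\<^bsub>G\<^esub> h) = \<rho> g \<otimes>\<^bsub>general_linear_group n\<^esub> \<rho> h"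
    using assms(2) g
    by (simp add: general_linear_group_def units_of_mult ring_mat_simps matrix_rep_def)
qed

lemma mat_trace_mult_commute:
  assumes "A \<in> carrier_mat n m" "B \<in> carrier_mat m n"
  shows "mat_trace (A * B) = mat_trace (B * A)"
proof -
  have "mat_trace (A * B) = (\<Sum>i<n. \<Sum>j<m. A $$ (i, j) * B $$ (j, i))"
    using assms by (simp add: mat_trace_def scalar_prod_def lessThan_atLeast0)
  also have "\<dots> = (\<Sum>j<m. \<Sum>i<n. B $$ (j, i) * A $$ (i, j))"
    by (subst sum.swap) (simp add: mult.commute)
  also have "\<dots> = mat_trace (B * A)"
    using assms by (simp add: mat_trace_def scalar_prod_def lessThan_atLeast0)
  finally show ?thesis .
qed

lemma mat_trace_four_block:
  assumes "A \<in> carrier_mat m m" "D \<in> carrier_mat k k"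
  shows "mat_trace (four_block_mat A B C D) = mat_trace A + mat_trace D"
proof -
  have "(\<Sum>i<m + k. four_block_mat A B C D $$ (i, i))
      = (\<Sum>i<m. four_block_mat A B C D $$ (i, i)) + (\<Sum>i<k. four_block_mat A B C D $$ (m + i, m + i))"
    by (induction k) (auto simp: add.assoc)
  then show ?thesis
    using assms by (simp add: mat_trace_def)
qed

text \<open>With a zero lower left block, the diagonal blocks of a product are the products of the
  diagonal blocks, and conjugation preserves the trace. Here \<open>A\<close> is the action on the
  span of the first \<open>m\<close> columns of \<open>P\<close>, and \<open>D\<close> the action on
  the quotient by it.\<close>

lemma block_triangular_rep:
  assumes "matrix_rep G (m + k) \<rho>"
    and P: "P \<in> carrier_mat (m + k) (m + k)" "Q \<in> carrier_mat (m + k) (m + k)" "P * Q = 1\<^sub>m (m + k)" "Q * P = 1\<^sub>m (m + k)"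
    and block: "\<And>g. g \<in> carrier G \<Longrightarrow> Q * \<rho> g * P = four_block_mat (A g) (B g) (0\<^sub>m k m) (D g)"
    and carr: "\<And>g. g \<in> carrier G \<Longrightarrow> A g \<in> carrier_mat m m \<and> B g \<in> carrier_mat m k \<and> D g \<in> carrier_mat k k"
    and "group G"
  shows "matrix_rep G m A" "matrix_rep G k D"
    "\<And>g. g \<in> carrier G \<Longrightarrow> mat_trace (\<rho> g) = mat_trace (A g) + mat_trace (D g)"
proof -
  interpret group G by fact
  have r: "\<rho> g \<in> carrier_mat (m + k) (m + k)" if "g \<in> carrier G" for g
    using assms(1) that by (auto simp: matrix_rep_def)
  note as = assoc_mult_mat[where ?n\<^sub>1 = "m + k" and ?n\<^sub>2 = "m + k" and ?n\<^sub>3 = "m + k" and ?n\<^sub>4 = "m + k"]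
  note cl = mult_carrier_mat[where ?nr = "m + k" and ?n = "m + k" and ?nc = "m + k"]
  \<comment> \<open>Once the block sizes are fixed, a block matrix determines its diagonal
    blocks.\<close>
  have eqD: "A1 = A2 \<and> D1 = D2"
    if "four_block_mat A1 B1 (0\<^sub>m k m) D1 = four_block_mat A2 B2 (0\<^sub>m k m) D2"
      "A1 \<in> carrier_mat m m" "D1 \<in> carrier_mat k k" "A2 \<in> carrier_mat m m" "D2 \<in> carrier_mat k k"
    for A1 A2 B1 B2 D1 D2 :: "complex mat"
  proof
    have e: "four_block_mat A1 B1 (0\<^sub>m k m) D1 $$ (i, j) = four_block_mat A2 B2 (0\<^sub>m k m) D2 $$ (i, j)" for i j
      using that(1) by simp
    show "A1 = A2"
    proof (rule eq_matI)
      fix i j assume "i < dim_row A2" "j < dim_col A2"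
      then show "A1 $$ (i, j) = A2 $$ (i, j)" using e[of i j] that(2-) by simp
    qed (use that(2-) in auto)
    show "D1 = D2"
    proof (rule eq_matI)
      fix i j assume "i < dim_row D2" "j < dim_col D2"
      then show "D1 $$ (i, j) = D2 $$ (i, j)" using e[of "m + i" "m + j"] that(2-) by simp
    qed (use that(2-) in auto)
  qed
  have one: "A \<one>\<^bsub>G\<^esub> = 1\<^sub>m m \<and> D \<one>\<^bsub>G\<^esub> = 1\<^sub>m k"
  proof -
    have "Q * \<rho> \<one>\<^bsub>G\<^esub> * P = 1\<^sub>m (m + k)"
      using assms(1) P by (simp add: matrix_rep_def)
    then show ?thesis
      using block[of "\<one>\<^bsub>G\<^esub>"] carr[of "\<one>\<^bsub>G\<^esub>"]
      by (intro eqD[of _ "B \<one>\<^bsub>G\<^esub>" _ _ "0\<^sub>m m k"]) auto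
  qed
  have mult: "A (g \<otimes>\<^bsub>G\<^esub> h) = A g * A h \<and> D (g \<otimes>\<^bsub>G\<^esub> h) = D g * D h"
    if g: "g \<in> carrier G" and h: "h \<in> carrier G" for g h
  proof -
    \<comment> \<open>The inserted identity is rewritten as \<open>P * Q\<close>, which turns the
      product into a product of two conjugates.\<close>
    have "Q * \<rho> (g \<otimes>\<^bsub>G\<^esub> h) * P = Q * (\<rho> g * 1\<^sub>m (m + k) * \<rho> h) * P"
      using assms(1) g h right_mult_one_mat[OF r[OF g]] by (simp add: matrix_rep_def)
    also have "\<dots> = (Q * \<rho> g * P) * (Q * \<rho> h * P)"
      unfolding P(3)[symmetric] using P(1,2) r[OF g] r[OF h]
      by (simp only: as cl)
    also have "\<dots> = four_block_mat (A g) (B g) (0\<^sub>m k m) (D g) * four_block_mat (A h) (B h) (0\<^sub>m k m) (D h)"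
      using block g h by simp
    also have "\<dots> = four_block_mat (A g * A h) (A g * B h + B g * D h) (0\<^sub>m k m) (D g * D h)"
      using carr[OF g] carr[OF h] by (subst mult_four_block_mat[where ?nr1.0=m and ?n1.0=m and ?n2.0=k and ?nr2.0=k and ?nc1.0=m and ?nc2.0=k]) (auto intro!: cong_four_block_mat)
    finally show ?thesis
      using block[of "g \<otimes>\<^bsub>G\<^esub> h"] carr[of "g \<otimes>\<^bsub>G\<^esub> h"] carr[OF g] carr[OF h] g h
      by (intro eqD[of _ "B (g \<otimes>\<^bsub>G\<^esub> h)" _ _ "A g * B h + B g * D h"]) auto
  qed
  show "matrix_rep G m A" "matrix_rep G k D"
    using one mult carr by (auto simp: matrix_rep_def)
  fix g assume g: "g \<in> carrier G"
  have "mat_trace (\<rho> g) = mat_trace (\<rho> g * P * Q)"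
    using P r[OF g] by (simp add: as[OF r[OF g] P(1,2)])
  also have "\<dots> = mat_trace (Q * (\<rho> g * P))"
    using P r[OF g] by (intro mat_trace_mult_commute) auto
  also have "\<dots> = mat_trace (A g) + mat_trace (D g)"
    using carr[OF g] block[OF g] by (simp add: mat_trace_four_block[where m = m and k = k] flip: as[OF P(2) r[OF g] P(1)])
  finally show "mat_trace (\<rho> g) = mat_trace (A g) + mat_trace (D g)" .
qed

text \<open>Spanning allows every unit vector to be written as \<open>?P *\<^sub>v y\<close>. These
  solutions are the columns of a right inverse, and a right inverse of a square matrix is
  two-sided.\<close>

lemma vec_space_mat_of_cols_inverse:
  fixes ws :: "complex vec list"
  assumes "length ws = n" "distinct ws" "set ws \<subseteq> carrier_vec n"
    and "LinearCombinations.module.span class_ring (module_vec TYPE(complex) n) (set ws) = carrier_vec n"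
  obtains Q where "Q \<in> carrier_mat n n" "mat_of_cols n ws * Q = 1\<^sub>m n" "Q * mat_of_cols n ws = 1\<^sub>m n"
proof -
  interpret vec_space "TYPE(complex)" n .
  let ?P = "mat_of_cols n ws"
  have P: "?P \<in> carrier_mat n n" using assms(1) by auto
  have "\<exists>y\<in>carrier_vec n. v = ?P *\<^sub>v y" if "v \<in> carrier_vec n" for v
  proof -
    have "v \<in> span (set ws)" using that assms(4) by simp
    then obtain c where c: "v = lincomb c (set ws)"
      using finite_in_span[OF _ assms(3)] by auto
    then have "v = lincomb_list (\<lambda>i. c (ws ! i)) ws"
      using lincomb_as_lincomb_list_distinct[OF assms(3,2)] by simp
    also have "\<dots> = ?P *\<^sub>v vec n (\<lambda>i. c (ws ! i))"
      using assms(1,3) by (subst lincomb_list_as_mat_mult) auto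
    finally show ?thesis by auto
  qed
  then obtain y where y: "\<And>v. v \<in> carrier_vec n \<Longrightarrow> y v \<in> carrier_vec n \<and> v = ?P *\<^sub>v y v"
    by metis
  define Q where "Q = mat_of_cols n (map (\<lambda>i. y (unit_vec n i)) [0..<n])"
  have Q: "Q \<in> carrier_mat n n" using mat_of_cols_carrier(1)[of n "map (\<lambda>i. y (unit_vec n i)) [0..<n]"] by (simp add: Q_def)
  have "?P * Q = 1\<^sub>m n"
  proof (rule mat_col_eqI)
    fix i assume "i < dim_col (1\<^sub>m n)"
    then have i: "i < n" by simp
    have "col Q i = y (unit_vec n i)"
      using i y[of "unit_vec n i"] unfolding Q_def by (subst col_mat_of_cols) auto
    then have "col (?P * Q) i = unit_vec n i"
      using i y[of "unit_vec n i"] col_mult2[OF P Q i] by simp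
    then show "col (?P * Q) i = col (1\<^sub>m n) i"
      using i by simp
  qed (use P Q in auto)
  then show thesis
    using that[OF Q] mat_mult_left_right_inverse[OF P Q] by simp
qed

text \<open>\<open>P\<close> is the matrix of a basis of the whole space whose first
  \<open>m\<close> vectors form a basis of \<open>W\<close>, and \<open>Q\<close> computes
  coordinates in it. The last property is what makes \<open>m < n\<close> for a proper
  subspace.\<close>

lemma subspace_adapted_basis:
  fixes W :: "complex vec set"
  assumes "subspace class_ring W (module_vec TYPE(complex) n)"
  obtains m P Q where "m \<le> n" "P \<in> carrier_mat n n" "Q \<in> carrier_mat n n" "P * Q = 1\<^sub>m n" "Q * P = 1\<^sub>m n"
    "\<And>j. j < m \<Longrightarrow> col P j \<in> W"
    "\<And>w i. w \<in> W \<Longrightarrow> m \<le> i \<Longrightarrow> i < n \<Longrightarrow> (Q *\<^sub>v w) $ i = 0"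
    "m = n \<Longrightarrow> W = carrier_vec n"
proof -
  interpret vec_space "TYPE(complex)" n .
  interpret W: submodule class_ring W V
    using assms by (simp add: VectorSpace.subspace_def)
  have WV: "W \<subseteq> carrier_vec n" using W.subset by simp
  have "finite A \<and> card A \<le> n" if "A \<subseteq> W \<and> lin_indpt A" for A
    using li_le_dim[of A] that WV by (auto simp: dim_is_n)
  moreover have "{} \<subseteq> W \<and> lin_indpt {}"
    by (simp add: lin_dep_def)
  ultimately have "\<exists>A. finite A \<and> maximal A (\<lambda>A. A \<subseteq> W \<and> lin_indpt A)"
    by (rule maximal_exists[where N = n])
  then obtain A where A: "finite A" "maximal A (\<lambda>A. A \<subseteq> W \<and> lin_indpt A)"
    by blast
  then have AW: "A \<subseteq> W" and liA: "lin_indpt A" by (auto simp: maximal_def)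
  have AV: "A \<subseteq> carrier_vec n" using AW WV by simp
  have spanA: "span A = W"
  proof
    show "span A \<subseteq> W"
      using AW W.submodule_axioms by (intro span_is_subset) auto
    show "W \<subseteq> span A"
    proof
      fix w assume w: "w \<in> W"
      show "w \<in> span A"
      proof (rule ccontr)
        assume n: "w \<notin> span A"
        then have "w \<notin> A" using in_own_span AV by auto
        then have "lin_indpt (A \<union> {w})"
          using lin_dep_iff_in_span[of A w] n AV liA w WV by auto
        then have "A \<union> {w} = A"
          using A(2) w AW unfolding maximal_def by (metis Un_insert_right Un_upper1 insert_subset sup_bot_right)
        then show False using \<open>w \<notin> A\<close> by auto
      qed
    qed
  qed
  \<comment> \<open>Steinitz exchange of the independent set \<open>A\<close> against the unit
    vectors.\<close>
  have "\<exists>C. finite C \<and> C \<subseteq> carrier_vec n \<and> C \<subseteq> span (set (unit_vecs n)) \<and> C \<inter> A = {} \<and>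
    int (card C) \<le> int (card (set (unit_vecs n :: complex vec list))) - int (card A) \<and> span (A \<union> C) = span (set (unit_vecs n))"
    using replacement[OF A(1), of "set (unit_vecs n)"] liA AV unfolding span_unit_vecs_is_carrier
    by (simp add: unit_vecs_carrier)
  then obtain C where C: "finite C" "C \<subseteq> carrier_vec n" "C \<inter> A = {}" "card C + card A \<le> n"
    "span (A \<union> C) = carrier_vec n"
    unfolding span_unit_vecs_is_carrier distinct_card[OF unit_vecs_distinct] unit_vecs_length
    by (metis of_nat_add of_nat_le_iff le_diff_eq)
  \<comment> \<open>The exchange bounds \<open>card C\<close> only from above. A generating set has
    at least \<open>n\<close> elements, so equality holds and the matrix of columns is
    square.\<close>
  have "n \<le> card (A \<union> C)"
    using gen_ge_dim[of "A \<union> C"] A(1) C AV by (auto simp: dim_is_n)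
  then have card: "card C + card A = n"
    using C A(1) card_Un_disjoint[of A C] by (simp add: Int_commute)
  obtain as cs where as: "set as = A" "distinct as" and cs: "set cs = C" "distinct cs"
    using finite_distinct_list A(1) C(1) by metis
  define m where "m = length as"
  have mA: "m = card A" using as m_def distinct_card by metis
  have "length cs = card C" using cs distinct_card by metis
  then have len: "length (as @ cs) = n" using card mA m_def by simp
  let ?P = "mat_of_cols n (as @ cs)"
  obtain Q where Q: "Q \<in> carrier_mat n n" "?P * Q = 1\<^sub>m n" "Q * ?P = 1\<^sub>m n"
    using vec_space_mat_of_cols_inverse[of "as @ cs" n] len as cs C(2,3,5) AV
    by (metis (no_types, lifting) Int_commute Un_least distinct_append set_append)
  have P: "?P \<in> carrier_mat n n" using len by (metis mat_of_cols_carrier(1))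
  show thesis
  proof (rule that[of m ?P Q])
    show "m \<le> n" using mA card by simp
    show "?P \<in> carrier_mat n n" "Q \<in> carrier_mat n n" "?P * Q = 1\<^sub>m n" "Q * ?P = 1\<^sub>m n" by fact+
    show "col ?P j \<in> W" if "j < m" for j
    proof -
      have "as ! j \<in> W" using that as AW m_def by auto
      then show ?thesis using that m_def len WV by (subst col_mat_of_cols) (auto simp: nth_append)
    qed
    show "(Q *\<^sub>v w) $ i = 0" if w: "w \<in> W" and i: "m \<le> i" "i < n" for w i
    proof -
      obtain c where c: "w = lincomb c A"
        using w finite_in_span[OF A(1)] AV spanA by auto
      \<comment> \<open>The coordinates of \<open>w\<close> with respect to \<open>as\<close>,
        padded by zeros at the positions of \<open>cs\<close>; hence
        \<open>Q *\<^sub>v w = y\<close>.\<close>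
      define y where "y = vec n (\<lambda>i. if i < m then c (as ! i) else 0)"
      have "w = lincomb_list (\<lambda>i. c (as ! i)) as"
        using c lincomb_as_lincomb_list_distinct[of as c] as AV by simp
      also have "\<dots> = mat_of_cols n as *\<^sub>v vec m (\<lambda>i. c (as ! i))"
        unfolding m_def by (rule lincomb_list_as_mat_mult) (use as AV in auto)
      also have "\<dots> = ?P *\<^sub>v y"
      proof (rule eq_vecI)
        fix k assume "k < dim_vec (?P *\<^sub>v y)"
        then have k: "k < n" by simp
        have "(?P *\<^sub>v y) $ k = (\<Sum>j<n. (as @ cs) ! j $ k * (if j < m then c (as ! j) else 0))"
          using k len by (simp add: scalar_prod_def mat_of_cols_index y_def lessThan_atLeast0)
        also have "\<dots> = (\<Sum>j<m. as ! j $ k * c (as ! j))"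
          using mA card m_def by (intro sum.mono_neutral_cong_right) (auto simp: nth_append)
        also have "\<dots> = (mat_of_cols n as *\<^sub>v vec m (\<lambda>i. c (as ! i))) $ k"
          using k by (simp add: scalar_prod_def mat_of_cols_index lessThan_atLeast0 m_def)
        finally show "(mat_of_cols n as *\<^sub>v vec m (\<lambda>i. c (as ! i))) $ k = (?P *\<^sub>v y) $ k" by simp
      qed simp
      finally have w: "w = ?P *\<^sub>v y" .
      have y: "y \<in> carrier_vec n" by (simp add: y_def)
      have "Q *\<^sub>v w = (Q * ?P) *\<^sub>v y"
        unfolding w by (rule assoc_mult_mat_vec[OF Q(1) P y, symmetric])
      then have "Q *\<^sub>v w = y" using y unfolding Q(3) by simp
      then show ?thesis using i by (simp add: y_def)
    qed
    show "W = carrier_vec n" if "m = n"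
    proof -
      have "C = {}" using that mA card C(1) by simp
      then show ?thesis using C(5) spanA by simp
    qed
  qed
qed

text \<open>The form used below: the blocks are cut out of the conjugated matrix, so that only the
  vanishing of the lower left entries remains to be checked.\<close>

lemma zero_block_rep:
  assumes \<rho>: "matrix_rep G (m + k) \<rho>"
    and P: "P \<in> carrier_mat (m + k) (m + k)" "Q \<in> carrier_mat (m + k) (m + k)" "P * Q = 1\<^sub>m (m + k)" "Q * P = 1\<^sub>m (m + k)"
    and zero: "\<And>g i j. g \<in> carrier G \<Longrightarrow> m \<le> i \<Longrightarrow> i < m + k \<Longrightarrow> j < m \<Longrightarrow> (Q * \<rho> g * P) $$ (i, j) = 0"
    and "group G"
  shows "matrix_rep G m (\<lambda>g. mat m m (\<lambda>(i, j). (Q * \<rho> g * P) $$ (i, j)))"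
    "matrix_rep G k (\<lambda>g. mat k k (\<lambda>(i, j). (Q * \<rho> g * P) $$ (m + i, m + j)))"
    "\<And>g. g \<in> carrier G \<Longrightarrow> mat_trace (\<rho> g) = mat_trace (mat m m (\<lambda>(i, j). (Q * \<rho> g * P) $$ (i, j)))
      + mat_trace (mat k k (\<lambda>(i, j). (Q * \<rho> g * P) $$ (m + i, m + j)))"
proof -
  let ?M = "\<lambda>g. Q * \<rho> g * P"
  have block: "?M g = four_block_mat (mat m m (\<lambda>(i, j). ?M g $$ (i, j))) (mat m k (\<lambda>(i, j). ?M g $$ (i, m + j)))
      (0\<^sub>m k m) (mat k k (\<lambda>(i, j). ?M g $$ (m + i, m + j)))" if g: "g \<in> carrier G" for g
    by (rule eq_matI) (use P \<rho> zero[OF g] g in \<open>auto simp: matrix_rep_def simp del: index_mult_mat(1)\<close>)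
  note * = block_triangular_rep[OF \<rho> P block _ assms(7)]
  show "matrix_rep G m (\<lambda>g. mat m m (\<lambda>(i, j). ?M g $$ (i, j)))"
    by (rule *(1)) auto
  show "matrix_rep G k (\<lambda>g. mat k k (\<lambda>(i, j). ?M g $$ (m + i, m + j)))"
    by (rule *(2)) auto
  show "mat_trace (\<rho> g) = mat_trace (mat m m (\<lambda>(i, j). ?M g $$ (i, j)))
      + mat_trace (mat k k (\<lambda>(i, j). ?M g $$ (m + i, m + j)))" if "g \<in> carrier G" for g
    by (rule *(3)[OF _ _ that]) auto
qed

text \<open>Strong induction on the degree. A reducible representation of positive degree has a
  proper nonzero invariant subspace, and its trace is the sum of the traces on this subspace and on
  the quotient, both of smaller degree.\<close>

theorem matrix_rep_effective:
  assumes "group G" "matrix_rep G n \<rho>"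
  shows "effective_character G (\<lambda>g. mat_trace (\<rho> g))"
  using assms(2)
proof (induction n arbitrary: \<rho> rule: less_induct)
  case (less n)
  have r: "\<rho> g \<in> carrier_mat n n" if "g \<in> carrier G" for g
    using less.prems that by (auto simp: matrix_rep_def)
  show ?case
  proof (cases "n = 0 \<or> irreducible_rep G n \<rho>")
    case True
    then show ?thesis
    proof
      assume "n = 0"
      then have "mat_trace (\<rho> g) = 0" if "g \<in> carrier G" for g
        using r[OF that] by (simp add: mat_trace_def)
      then show ?thesis by (intro effective_character_cong[OF effective_character_zero]) simp
    next
      assume "irreducible_rep G n \<rho>"
      then have "restrict (\<lambda>g. mat_trace (\<rho> g)) (carrier G) \<in> irreducible_characters G"
        unfolding irreducible_characters_def by blast
      then show ?thesis
        unfolding effective_character_def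
        by (intro exI[of _ "{restrict (\<lambda>g. mat_trace (\<rho> g)) (carrier G)}"] exI[of _ "\<lambda>_. 1"]) auto
    qed
  next
    case False
    then obtain W where sub: "subspace class_ring W (module_vec TYPE(complex) n)"
      and inv: "\<And>g w. g \<in> carrier G \<Longrightarrow> w \<in> W \<Longrightarrow> \<rho> g *\<^sub>v w \<in> W"
      and W: "W \<noteq> {0\<^sub>v n}" "W \<noteq> carrier_vec n"
      using matrix_rep_in_hom[OF assms(1) less.prems] unfolding irreducible_rep_def by auto
    obtain m P Q where m: "m \<le> n" and PQ: "P \<in> carrier_mat n n" "Q \<in> carrier_mat n n" "P * Q = 1\<^sub>m n" "Q * P = 1\<^sub>m n"
      and colP: "\<And>j. j < m \<Longrightarrow> col P j \<in> W"
      and QW: "\<And>w i. w \<in> W \<Longrightarrow> m \<le> i \<Longrightarrow> i < n \<Longrightarrow> (Q *\<^sub>v w) $ i = 0"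
      and mn: "m = n \<Longrightarrow> W = carrier_vec n"
      by (rule subspace_adapted_basis[OF sub]) (rule that; assumption)
    have subm: "W \<subseteq> carrier_vec n" "0\<^sub>v n \<in> W"
      using submodule.subset[of class_ring W "module_vec TYPE(complex) n"]
        submodule.zero_closed[of class_ring W "module_vec TYPE(complex) n"] sub
      unfolding VectorSpace.subspace_def by (auto simp: module_vec_simps)
    \<comment> \<open>For \<open>m = 0\<close> all coordinates of every vector of \<open>W\<close>
      would vanish, and \<open>W\<close> would be the zero space.\<close>
    have "m \<noteq> 0"
    proof
      assume "m = 0"
      have "w = 0\<^sub>v n" if w: "w \<in> W" for w
      proof -
        have wc: "w \<in> carrier_vec n" using subm w by auto
        have "Q *\<^sub>v w = 0\<^sub>v n"
          using QW[OF w] \<open>m = 0\<close> PQ by (intro eq_vecI) auto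
        then have "P *\<^sub>v (Q *\<^sub>v w) = 0\<^sub>v n" using PQ(1) by (intro eq_vecI) auto
        then have "(P * Q) *\<^sub>v w = 0\<^sub>v n" using assoc_mult_mat_vec[OF PQ(1,2) wc] by simp
        then show ?thesis using wc unfolding PQ(3) by simp
      qed
      then show False using subm(2) W(1) by (metis singleton_iff subsetI subset_singletonD empty_iff)
    qed
    moreover have "m < n" using m mn W(2) by (cases "m = n") auto
    moreover define k where "k = n - m"
    ultimately have k: "n = m + k" "m < n" "k < n" by auto
    define M where "M g = Q * \<rho> g * P" for g
    have Mc: "M g \<in> carrier_mat n n" if "g \<in> carrier G" for g using PQ r[OF that] by (simp add: M_def)
    \<comment> \<open>Column \<open>j\<close> of \<open>M g\<close> holds the coordinates of the
      image under \<open>\<rho> g\<close> of the basis vector \<open>col P j\<close>. That image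
      stays in \<open>W\<close>, where the coordinates from \<open>m\<close> on are zero.\<close>
    have zero: "M g $$ (i, j) = 0" if g: "g \<in> carrier G" and ij: "m \<le> i" "i < n" "j < m" for g i j
    proof -
      have j: "j < n" using ij by simp
      have "M g $$ (i, j) = col (M g) j $ i"
        using Mc[OF g] ij j by simp
      also have "col (M g) j = Q *\<^sub>v (\<rho> g *\<^sub>v col P j)"
        unfolding M_def assoc_mult_mat[OF PQ(2) r[OF g] PQ(1)]
          col_mult2[OF PQ(2) mult_carrier_mat[OF r[OF g] PQ(1)] j] col_mult2[OF r[OF g] PQ(1) j] ..
      also have "(Q *\<^sub>v (\<rho> g *\<^sub>v col P j)) $ i = 0" using QW inv g colP ij by simp
      finally show ?thesis .
    qed
    note * = zero_block_rep[OF less.prems[unfolded k(1)] PQ[unfolded k(1)] _ assms(1), folded k(1) M_def, OF zero]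
    show ?thesis
      by (rule effective_character_cong[OF effective_character_add[OF less.IH[OF _ *(1)] less.IH[OF _ *(2)]]])
        (use *(3) k in auto)
  qed
qed

section \<open>Permutation characters\<close>

text \<open>The action in question is precomposition of functions with \<open>g\<close>, which
  reverses the order of factors.\<close>

definition right_action :: "('g, 'b) monoid_scheme \<Rightarrow> 'x set \<Rightarrow> ('g \<Rightarrow> 'x \<Rightarrow> 'x) \<Rightarrow> bool" where
  "right_action G X act \<longleftrightarrow>
     (\<forall>g\<in>carrier G. \<forall>x\<in>X. act g x \<in> X) \<and> (\<forall>x\<in>X. act \<one>\<^bsub>G\<^esub> x = x) \<and>
     (\<forall>g\<in>carrier G. \<forall>h\<in>carrier G. \<forall>x\<in>X. act (g \<otimes>\<^bsub>G\<^esub> h) x = act h (act g x))"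

text \<open>Applied to a column vector, read as a function \<open>c\<close> on the listed points,
  this gives \<open>\<lambda>x. c (act g x)\<close>. Placing the 1 of row \<open>i\<close> at the
  image of \<open>e i\<close> is what makes a right action into a homomorphism.\<close>

definition permutation_mat :: "('g \<Rightarrow> 'x \<Rightarrow> 'x) \<Rightarrow> nat \<Rightarrow> (nat \<Rightarrow> 'x) \<Rightarrow> 'g \<Rightarrow> complex mat" where
  "permutation_mat act n e g = mat n n (\<lambda>(i, j). of_bool (act g (e i) = e j))"

lemma sum_of_bool_eq:
  fixes n :: nat
  assumes "bij_betw e {..<n} X" "x \<in> X"
  shows "(\<Sum>i<n. of_bool (x = e i) * c (e i)) = (c x :: complex)"
proof -
  have "(\<Sum>i<n. of_bool (x = e i) * c (e i)) = (\<Sum>y\<in>X. of_bool (x = y) * c y)"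
    by (rule sum.reindex_bij_betw[OF assms(1)])
  also have "\<dots> = c x"
    using assms bij_betw_finite[OF assms(1)]
    by (simp add: of_bool_def if_distrib[of "\<lambda>a. a * _"] cong: if_cong)
  finally show ?thesis .
qed

lemma permutation_mat_rep:
  assumes "group G" "right_action G X act" and e: "bij_betw e {..<n} X"
  shows "matrix_rep G n (permutation_mat act n e)"
    and "mat_trace (permutation_mat act n e g) = of_nat (card {x\<in>X. act g x = x})"
proof -
  interpret group G by fact
  have eX: "e i \<in> X" if "i < n" for i
    using e that by (auto simp: bij_betw_def)
  have eq: "e i = e j \<longleftrightarrow> i = j" if "i < n" "j < n" for i j
    using e that by (auto simp: bij_betw_def inj_on_def)
  have one: "permutation_mat act n e \<one>\<^bsub>G\<^esub> = 1\<^sub>m n"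
    using assms(2) eX by (intro eq_matI) (auto simp: permutation_mat_def right_action_def eq)
  have mult: "permutation_mat act n e (g \<otimes>\<^bsub>G\<^esub> h) = permutation_mat act n e g * permutation_mat act n e h"
    if g: "g \<in> carrier G" and h: "h \<in> carrier G" for g h
  proof (rule eq_matI)
    fix i j assume "i < dim_row (permutation_mat act n e g * permutation_mat act n e h)"
      "j < dim_col (permutation_mat act n e g * permutation_mat act n e h)"
    then have ij: "i < n" "j < n" by (auto simp: permutation_mat_def)
    have "(permutation_mat act n e g * permutation_mat act n e h) $$ (i, j)
        = (\<Sum>l<n. of_bool (act g (e i) = e l) * of_bool (act h (e l) = e j))"
      using ij by (simp add: permutation_mat_def scalar_prod_def lessThan_atLeast0)
    also have "\<dots> = of_bool (act h (act g (e i)) = e j)"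
      using assms(2) g ij eX by (intro sum_of_bool_eq[OF e]) (auto simp: right_action_def)
    finally show "permutation_mat act n e (g \<otimes>\<^bsub>G\<^esub> h) $$ (i, j)
        = (permutation_mat act n e g * permutation_mat act n e h) $$ (i, j)"
      using assms(2) g h ij eX by (simp add: permutation_mat_def right_action_def)
  qed (auto simp: permutation_mat_def)
  show "matrix_rep G n (permutation_mat act n e)"
    using one mult by (auto simp: matrix_rep_def permutation_mat_def)
  have "(\<Sum>i<n. of_bool (act g (e i) = e i)) = (\<Sum>x\<in>X. of_bool (act g x = x) :: complex)"
    by (rule sum.reindex_bij_betw[OF e])
  also have "\<dots> = of_nat (card {x\<in>X. act g x = x})"
    using bij_betw_finite[OF e] by (simp add: of_bool_def flip: sum.inter_filter)
  finally show "mat_trace (permutation_mat act n e g) = of_nat (card {x\<in>X. act g x = x})"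
    by (simp add: mat_trace_def permutation_mat_def)
qed

text \<open>
  Functions on \<open>X\<close> pull back along \<open>\<pi>\<close> to a subrepresentation of the functions on \<open>Y\<close>; the
  difference of the two permutation characters is the character of the quotient.
\<close>

theorem permutation_character_le:
  assumes G: "group G" and X: "finite X" "right_action G X actX" and Y: "finite Y" "right_action G Y actY"
    and \<pi>: "\<pi> ` Y = X" "\<And>g y. g \<in> carrier G \<Longrightarrow> y \<in> Y \<Longrightarrow> \<pi> (actY g y) = actX g (\<pi> y)"
  shows "character_le G (\<lambda>g. of_nat (card {x\<in>X. actX g x = x})) (\<lambda>g. of_nat (card {y\<in>Y. actY g y = y}))"
proof -
  \<comment> \<open>One point is chosen in each fibre of \<open>\<pi>\<close>. Listing these points
    first makes the upper block of \<open>T\<close> the identity, so that \<open>P\<close> is block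
    unitriangular with the explicit inverse \<open>Q\<close>.\<close>
  define s where "s = inv_into Y \<pi>"
  have s: "s x \<in> Y \<and> \<pi> (s x) = x" if "x \<in> X" for x
    using that inv_into_into[of x \<pi> Y] f_inv_into_f[of x \<pi> Y] \<pi>(1) by (simp add: s_def)
  define m where "m = card X"
  define k where "k = card (Y - s ` X)"
  obtain a where a: "bij_betw a {..<m} X"
    using ex_bij_betw_nat_finite[OF X(1)] by (auto simp: m_def lessThan_atLeast0)
  obtain b where b: "bij_betw b {..<k} (Y - s ` X)"
    using ex_bij_betw_nat_finite[of "Y - s ` X"] Y(1) by (auto simp: k_def lessThan_atLeast0)
  define e where "e i = (if i < m then s (a i) else b (i - m))" for i
  have aX: "a i \<in> X" if "i < m" for i
    using a that by (auto simp: bij_betw_def)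
  have inj_s: "inj_on s X" by (rule inj_on_inverseI[where g = \<pi>]) (use s in simp)
  have "bij_betw e {..<m} (s ` X)"
  proof -
    have "bij_betw (s \<circ> a) {..<m} (s ` X)"
      by (rule bij_betw_trans[OF a inj_on_imp_bij_betw[OF inj_s]])
    then show ?thesis by (rule bij_betw_cong[THEN iffD1, rotated]) (simp add: e_def)
  qed
  moreover have "bij_betw e {m..<m + k} (Y - s ` X)"
  proof -
    have "bij_betw (\<lambda>i. i - m) {m..<m + k} {..<k}"
      by (rule bij_betwI[where g = "\<lambda>i. i + m"]) auto
    then have "bij_betw (b \<circ> (\<lambda>i. i - m)) {m..<m + k} (Y - s ` X)"
      using b by (rule bij_betw_trans)
    then show ?thesis by (rule bij_betw_cong[THEN iffD1, rotated]) (simp add: e_def)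
  qed
  ultimately have "bij_betw e ({..<m} \<union> {m..<m + k}) (s ` X \<union> (Y - s ` X))"
    by (rule bij_betw_combine) auto
  moreover have "{..<m} \<union> {m..<m + k} = {..<m + k}" "s ` X \<union> (Y - s ` X) = Y"
    using s by auto
  ultimately have e: "bij_betw e {..<m + k} Y" by simp
  have eY: "e i \<in> Y" if "i < m + k" for i
    using e that by (auto simp: bij_betw_def)
  have \<pi>e: "\<pi> (e i) = a i" if "i < m" for i
    using that s aX by (simp add: e_def)
  have a_eq: "a i = a j \<longleftrightarrow> i = j" if "i < m" "j < m" for i j
    using a that by (auto simp: bij_betw_def inj_on_def)
  let ?\<rho> = "permutation_mat actY (m + k) e" and ?\<sigma> = "permutation_mat actX m a"
  \<comment> \<open>\<open>T\<close> is the pullback along \<open>\<pi>\<close>: its column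
    \<open>j\<close> is the indicator function of the fibre over \<open>a j\<close>.
    \<open>E\<close> is the inclusion of the first \<open>m\<close> coordinates, and the first
    \<open>m\<close> columns of \<open>P\<close> are those of \<open>T\<close>.\<close>
  define T where "T = mat (m + k) m (\<lambda>(i, j). of_bool (\<pi> (e i) = a j) :: complex)"
  define C where "C = mat k m (\<lambda>(i, j). T $$ (m + i, j))"
  define E where "E = mat (m + k) m (\<lambda>(i, j). of_bool (i = j) :: complex)"
  define P where "P = four_block_mat (1\<^sub>m m) (0\<^sub>m m k) C (1\<^sub>m k)"
  define Q where "Q = four_block_mat (1\<^sub>m m) (0\<^sub>m m k) (- C) (1\<^sub>m k)"
  have carr: "T \<in> carrier_mat (m + k) m" "C \<in> carrier_mat k m" "E \<in> carrier_mat (m + k) m"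
    "P \<in> carrier_mat (m + k) (m + k)" "Q \<in> carrier_mat (m + k) (m + k)"
    by (simp_all add: T_def C_def E_def P_def Q_def)
  note block_mult = mult_four_block_mat[where ?nr1.0=m and ?n1.0=m and ?n2.0=k and ?nr2.0=k and ?nc1.0=m and ?nc2.0=k]
  have PQ: "P * Q = 1\<^sub>m (m + k)" "Q * P = 1\<^sub>m (m + k)"
    unfolding P_def Q_def four_block_one_mat[symmetric]
    by (subst block_mult; use carr(2) in \<open>auto intro!: cong_four_block_mat eq_matI\<close>)+
  have right_E: "(M * E) $$ (i, j) = M $$ (i, j)"
    if "M \<in> carrier_mat (m + k) (m + k)" "i < m + k" "j < m" for M i j
  proof -
    have "(M * E) $$ (i, j) = (\<Sum>l<m + k. M $$ (i, l) * of_bool (l = j))"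
      using that by (simp add: E_def scalar_prod_def lessThan_atLeast0)
    also have "\<dots> = (\<Sum>l\<in>{j}. M $$ (i, l) * of_bool (l = j))"
      using that by (intro sum.mono_neutral_right) auto
    finally show ?thesis by simp
  qed
  have PE: "P * E = T"
  proof (rule eq_matI)
    fix i j assume "i < dim_row T" "j < dim_col T"
    then have ij: "i < m + k" "j < m" by (auto simp: T_def)
    show "(P * E) $$ (i, j) = T $$ (i, j)"
      unfolding right_E[OF carr(4) ij] using ij \<pi>e a_eq by (auto simp: P_def C_def T_def)
  qed (use carr in auto)
  have QT: "Q * T = E"
    unfolding PE[symmetric] using assoc_mult_mat[OF carr(5,4,3)] carr(3) PQ(2) by simp
  have \<rho>c: "?\<rho> g \<in> carrier_mat (m + k) (m + k)" and \<sigma>c: "?\<sigma> g \<in> carrier_mat m m" for g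
    by (auto simp: permutation_mat_def)
  \<comment> \<open>Equivariance of \<open>\<pi>\<close> in matrix form: \<open>T\<close>
    intertwines the two permutation representations.\<close>
  have \<rho>T: "?\<rho> g * T = T * ?\<sigma> g" if g: "g \<in> carrier G" for g
  proof (rule eq_matI)
    fix i j assume "i < dim_row (T * ?\<sigma> g)" "j < dim_col (T * ?\<sigma> g)"
    then have ij: "i < m + k" "j < m" by (auto simp: T_def permutation_mat_def)
    have "(?\<rho> g * T) $$ (i, j) = (\<Sum>l<m + k. of_bool (actY g (e i) = e l) * of_bool (\<pi> (e l) = a j))"
      using ij by (simp add: permutation_mat_def T_def scalar_prod_def lessThan_atLeast0)
    also have "\<dots> = of_bool (\<pi> (actY g (e i)) = a j)"
      using Y(2) g ij eY by (intro sum_of_bool_eq[OF e]) (auto simp: right_action_def)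
    also have "\<dots> = of_bool (actX g (\<pi> (e i)) = a j)"
      using \<pi>(2) g eY ij by simp
    also have "\<dots> = (\<Sum>l<m. of_bool (\<pi> (e i) = a l) * of_bool (actX g (a l) = a j))"
      using \<pi>(1) ij eY by (intro sum_of_bool_eq[OF a, symmetric]) auto
    also have "\<dots> = (T * ?\<sigma> g) $$ (i, j)"
      using ij by (simp add: permutation_mat_def T_def scalar_prod_def lessThan_atLeast0)
    finally show "(?\<rho> g * T) $$ (i, j) = (T * ?\<sigma> g) $$ (i, j)" .
  qed (use carr in \<open>auto simp: permutation_mat_def\<close>)
  \<comment> \<open>Multiplication by \<open>E\<close> selects the first \<open>m\<close> columns.
    Since \<open>P * E = T\<close> and \<open>Q * T = E\<close>, the intertwining relation turns
    them into \<open>E * ?\<sigma> g\<close>, which is \<open>?\<sigma> g\<close> above a zero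
    block.\<close>
  have first_cols: "(Q * ?\<rho> g * P) $$ (i, j) = (E * ?\<sigma> g) $$ (i, j)"
    if g: "g \<in> carrier G" and ij: "i < m + k" "j < m" for g i j
  proof -
    have "(Q * ?\<rho> g * P) * E = Q * ?\<rho> g * T"
      using assoc_mult_mat[OF mult_carrier_mat[OF carr(5) \<rho>c] carr(4,3)] PE by simp
    also have "\<dots> = Q * T * ?\<sigma> g"
      using assoc_mult_mat[OF carr(5) \<rho>c carr(1)] assoc_mult_mat[OF carr(5,1) \<sigma>c] \<rho>T[OF g] by simp
    finally have "(Q * ?\<rho> g * P) * E = E * ?\<sigma> g" unfolding QT .
    then show ?thesis
      using right_E[of "Q * ?\<rho> g * P" i j] carr \<rho>c ij by (metis mult_carrier_mat)
  qed
  have E\<sigma>: "(E * ?\<sigma> g) $$ (i, j) = (if i < m then ?\<sigma> g $$ (i, j) else 0)" if "i < m + k" "j < m" for g i j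
  proof -
    have "(E * ?\<sigma> g) $$ (i, j) = (\<Sum>l<m. of_bool (i = l) * ?\<sigma> g $$ (l, j))"
      using that \<sigma>c[of g] by (simp add: E_def scalar_prod_def lessThan_atLeast0)
    also have "\<dots> = (if i < m then ?\<sigma> g $$ (i, j) else 0)"
      by (simp add: of_bool_def if_distrib[of "\<lambda>a. a * _"] cong: if_cong)
    finally show ?thesis .
  qed
  note rep\<rho> = permutation_mat_rep[OF G Y(2) e] and rep\<sigma> = permutation_mat_rep[OF G X(2) a]
  have zero: "(Q * ?\<rho> g * P) $$ (i, j) = 0" if "g \<in> carrier G" "m \<le> i" "i < m + k" "j < m" for g i j
    using first_cols[OF that(1,3,4)] E\<sigma>[OF that(3,4)] that by simp
  note * = zero_block_rep[OF rep\<rho>(1) carr(4,5) PQ zero G]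
  let ?D = "\<lambda>g. mat k k (\<lambda>(i, j). (Q * ?\<rho> g * P) $$ (m + i, m + j))"
  have "mat m m (\<lambda>(i, j). (Q * ?\<rho> g * P) $$ (i, j)) = ?\<sigma> g" if g: "g \<in> carrier G" for g
    using \<sigma>c[of g] first_cols[OF g] E\<sigma> by (intro eq_matI) auto
  then have "mat_trace (?\<rho> g) = mat_trace (?\<sigma> g) + mat_trace (?D g)" if "g \<in> carrier G" for g
    using *(3)[OF _ _ _ _ that] that by simp
  then show ?thesis
    unfolding character_le_def
    by (intro effective_character_cong[OF matrix_rep_effective[OF G *(2)]])
      (auto simp: rep\<rho>(2) rep\<sigma>(2))
qed

lemma permutation_character_effective:
  assumes "group G" "finite X" "right_action G X act"
  shows "effective_character G (\<lambda>g. of_nat (card {x\<in>X. act g x = x}))"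
proof -
  obtain e where "bij_betw e {..<card X} X"
    using ex_bij_betw_nat_finite[OF assms(2)] by (auto simp: lessThan_atLeast0)
  note * = permutation_mat_rep[OF assms(1,3) this]
  show ?thesis
    using matrix_rep_effective[OF assms(1) *(1)] by (simp add: *(2))
qed

text \<open>For a right action, \<open>act h\<close> carries the fixed points of the conjugate of
  \<open>g\<close> by \<open>h\<close> onto the fixed points of \<open>g\<close>.\<close>

lemma class_function_card_fixed:
  assumes "group G" "finite X" "right_action G X act"
  shows "class_function G (\<lambda>g. card {x\<in>X. act g x = x})"
  unfolding class_function_def
proof (intro ballI)
  interpret group G by fact
  fix g h assume gh: "g \<in> carrier G" "h \<in> carrier G"
  have cl: "act a x \<in> X" if "a \<in> carrier G" "x \<in> X" for a x
    using assms(3) that by (simp add: right_action_def)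
  have inv: "act (inv\<^bsub>G\<^esub> a) (act a x) = x" "act a (act (inv\<^bsub>G\<^esub> a) x) = x"
    if "a \<in> carrier G" "x \<in> X" for a x
    using assms(3) that r_inv[of a] l_inv[of a] inv_closed[of a] unfolding right_action_def by metis+
  have conj: "act (h \<otimes>\<^bsub>G\<^esub> g \<otimes>\<^bsub>G\<^esub> inv\<^bsub>G\<^esub> h) x = act (inv\<^bsub>G\<^esub> h) (act g (act h x))" if "x \<in> X" for x
    using assms(3) gh that by (simp add: right_action_def)
  have iff: "act (h \<otimes>\<^bsub>G\<^esub> g \<otimes>\<^bsub>G\<^esub> inv\<^bsub>G\<^esub> h) x = x \<longleftrightarrow> act g (act h x) = act h x" if "x \<in> X" for x
    unfolding conj[OF that] using inv[of h] gh cl that by metis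
  have "bij_betw (act h) {x\<in>X. act (h \<otimes>\<^bsub>G\<^esub> g \<otimes>\<^bsub>G\<^esub> inv\<^bsub>G\<^esub> h) x = x} {x\<in>X. act g x = x}"
    by (rule bij_betwI[where g = "act (inv\<^bsub>G\<^esub> h)"]) (use iff inv gh cl in auto)
  then show "card {x\<in>X. act (h \<otimes>\<^bsub>G\<^esub> g \<otimes>\<^bsub>G\<^esub> inv\<^bsub>G\<^esub> h) x = x} = card {x\<in>X. act g x = x}"
    by (rule bij_betw_same_card)
qed

text \<open>Here \<pi> may map points of \<open>Y\<close> outside \<open>X\<close>. The part
  \<open>Z\<close> that it maps into \<open>X\<close> is invariant, as seen by applying the inverse
  group element, and is compared with \<open>X\<close>; the complement of \<open>Z\<close> adds an
  effective permutation character.\<close>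

lemma permutation_character_le_partial:
  assumes G: "group G" and X: "finite X" "right_action G X actX" and Y: "finite Y" "right_action G Y actY"
    and \<pi>: "X \<subseteq> \<pi> ` Y" "\<And>g y. g \<in> carrier G \<Longrightarrow> y \<in> Y \<Longrightarrow> \<pi> (actY g y) = actX g (\<pi> y)"
  shows "character_le G (\<lambda>g. of_nat (card {x\<in>X. actX g x = x})) (\<lambda>g. of_nat (card {y\<in>Y. actY g y = y}))"
proof -
  interpret group G by fact
  define Z where "Z = {y\<in>Y. \<pi> y \<in> X}"
  have inX: "\<pi> (actY g y) \<in> X \<longleftrightarrow> \<pi> y \<in> X" if g: "g \<in> carrier G" and y: "y \<in> Y" for g y
  proof
    assume "\<pi> y \<in> X"
    then show "\<pi> (actY g y) \<in> X" using \<pi>(2)[OF g y] X(2) g by (simp add: right_action_def)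
  next
    assume *: "\<pi> (actY g y) \<in> X"
    have "actY g y \<in> Y" using Y(2) g y by (simp add: right_action_def)
    moreover have "actY (inv\<^bsub>G\<^esub> g) (actY g y) = y"
      using Y(2) g y r_inv[OF g] inv_closed[OF g] unfolding right_action_def by metis
    ultimately have "\<pi> y = actX (inv\<^bsub>G\<^esub> g) (\<pi> (actY g y))"
      using \<pi>(2)[of "inv\<^bsub>G\<^esub> g" "actY g y"] g by simp
    then show "\<pi> y \<in> X" using * X(2) g by (simp add: right_action_def)
  qed
  have actZ: "right_action G Z actY" "right_action G (Y - Z) actY"
    using Y(2) inX by (auto simp: right_action_def Z_def)
  have "\<pi> ` Z = X" using \<pi>(1) by (auto simp: Z_def)
  then have "character_le G (\<lambda>g. of_nat (card {x\<in>X. actX g x = x})) (\<lambda>g. of_nat (card {y\<in>Z. actY g y = y}))"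
    using Y(1) \<pi>(2) by (intro permutation_character_le[OF G X _ actZ(1)]) (auto simp: Z_def)
  moreover have "effective_character G (\<lambda>g. of_nat (card {y\<in>Y - Z. actY g y = y}))"
    using Y(1) by (intro permutation_character_effective[OF G _ actZ(2)]) simp
  ultimately have "effective_character G (\<lambda>g. (of_nat (card {y\<in>Z. actY g y = y}) - of_nat (card {x\<in>X. actX g x = x}))
      + of_nat (card {y\<in>Y - Z. actY g y = y}))"
    unfolding character_le_def by (rule effective_character_add)
  moreover have "card {y\<in>Y. actY g y = y} = card {y\<in>Z. actY g y = y} + card {y\<in>Y - Z. actY g y = y}" for g
  proof -
    have "{y\<in>Y. actY g y = y} = {y\<in>Z. actY g y = y} \<union> {y\<in>Y - Z. actY g y = y}"
      by (auto simp: Z_def)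
    then show ?thesis
      using Y(1) by (simp only:) (rule card_Un_disjoint; auto simp: Z_def)
  qed
  ultimately show ?thesis
    unfolding character_le_def by (auto intro: effective_character_cong)
qed

section \<open>Symmetric chain decompositions\<close>

text \<open>For finite \<open>A\<close> two comparable sets of equal size coincide, so each rank
  from \<open>j\<close> to \<open>card A - j\<close> is met exactly once.\<close>

definition symmetric_chain :: "'a set \<Rightarrow> 'a set set \<Rightarrow> bool" where
  "symmetric_chain A C \<longleftrightarrow> C \<subseteq> Pow A \<and> (\<forall>S\<in>C. \<forall>T\<in>C. S \<subseteq> T \<or> T \<subseteq> S) \<and>
     (\<exists>j. 2 * j \<le> card A \<and> card ` C = {j..card A - j})"

lemma symmetric_chainI:
  assumes "card ` C = {j..card A - j}" "C \<subseteq> Pow A"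
    and "\<And>S T. S \<in> C \<Longrightarrow> T \<in> C \<Longrightarrow> S \<subseteq> T \<or> T \<subseteq> S" and "2 * j \<le> card A"
  shows "symmetric_chain A C"
  using assms unfolding symmetric_chain_def by (intro conjI ballI exI[of _ j]) simp_all

lemma symmetric_chainE:
  assumes "symmetric_chain A C"
  obtains j where "card ` C = {j..card A - j}" "C \<subseteq> Pow A"
    "\<And>S T. S \<in> C \<Longrightarrow> T \<in> C \<Longrightarrow> S \<subseteq> T \<or> T \<subseteq> S" "2 * j \<le> card A"
proof -
  obtain j where "2 * j \<le> card A \<and> card ` C = {j..card A - j}"
    using assms unfolding symmetric_chain_def by (elim conjE) (rule exE)
  then show thesis
    using that[of j] assms unfolding symmetric_chain_def by simp
qed

text \<open>The inductive construction of de Bruijn, Tengbergen and Kruyswijk, with \<open>t\<close>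
  the top of \<open>C\<close>. If \<open>C\<close> occupies the ranks \<open>j\<close> to
  \<open>card A - j\<close>, the long chain ends one rank higher. The short chain omits the top and
  adds \<open>a\<close> to the rest, so it occupies the ranks \<open>j + 1\<close> to
  \<open>card A - j\<close>. Both are symmetric about half of \<open>card A + 1\<close>.\<close>

lemma symmetric_chain_insert:
  assumes "finite A" "a \<notin> A" "symmetric_chain A C"
  shows "\<exists>t\<in>C. symmetric_chain (insert a A) (insert (insert a t) C) \<and>
    (C \<noteq> {t} \<longrightarrow> symmetric_chain (insert a A) (insert a ` (C - {t})))"
proof -
  obtain j where C: "C \<subseteq> Pow A" "\<And>S T. S \<in> C \<Longrightarrow> T \<in> C \<Longrightarrow> S \<subseteq> T \<or> T \<subseteq> S"
    and j: "2 * j \<le> card A" "card ` C = {j..card A - j}"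
    using assms(3) unfolding symmetric_chain_def by auto
  have "card A - j \<in> card ` C" using j by auto
  then obtain t where t: "t \<in> C" "card t = card A - j" by (metis imageE)
  have fin: "finite S" if "S \<in> C" for S
    using that C(1) assms(1) by (meson PowD finite_subset subsetD)
  have card_le: "j \<le> card S \<and> card S \<le> card t" if "S \<in> C" for S
  proof -
    have "card S \<in> {j..card A - j}" using that j(2) by blast
    then show ?thesis using t(2) by simp
  qed
  have top: "S \<subseteq> t" if "S \<in> C" for S
    using C(2)[OF that t(1)] card_le[OF that] card_seteq[OF fin[OF that], of t] by auto
  have uniq: "S = t" if "S \<in> C" "card S = card t" for S
    using card_subset_eq[OF fin[OF t(1)] top[OF that(1)] that(2)] .
  have a: "a \<notin> S" if "S \<in> C" for S using that C(1) assms(2) by auto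
  have card_insert: "card (insert a S) = Suc (card S)" if "S \<in> C" for S
    using fin[OF that] a[OF that] by simp
  have "card ` insert (insert a t) C = {j..card (insert a A) - j}"
    using card_insert[OF t(1)] t(2) j assms(1,2) by (auto simp: atLeastAtMostSuc_conv Suc_diff_le)
  moreover have "insert (insert a t) C \<subseteq> Pow (insert a A)"
    using C(1) t(1) by auto
  moreover have "S \<subseteq> T \<or> T \<subseteq> S"
    if "S \<in> insert (insert a t) C" "T \<in> insert (insert a t) C" for S T
    using that C(2)[of S T] top[of S] top[of T] by blast
  moreover have "2 * j \<le> card (insert a A)" using j(1) assms(1,2) by simp
  ultimately have 1: "symmetric_chain (insert a A) (insert (insert a t) C)"
    by (rule symmetric_chainI)
  \<comment> \<open>A one-element chain would leave an empty short chain, whose set of ranks is not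
    of the required form; a second element forces \<open>j < card A - j\<close>.\<close>
  have 2: "symmetric_chain (insert a A) (insert a ` (C - {t}))" if ne: "C \<noteq> {t}"
  proof -
    obtain S where S: "S \<in> C" "S \<noteq> t" using ne t(1) by auto
    then have lt: "j < card A - j" using card_le[OF S(1)] uniq[OF S(1)] t(2) by linarith
    have "card ` (C - {t}) = card ` C - {card t}"
    proof
      show "card ` (C - {t}) \<subseteq> card ` C - {card t}"
        by (auto dest: uniq)
      show "card ` C - {card t} \<subseteq> card ` (C - {t})"
        by auto
    qed
    then have "card ` (C - {t}) = {j..card A - j} - {card A - j}"
      unfolding j(2) t(2) .
    then have "Suc ` card ` (C - {t}) = Suc ` ({j..card A - j} - {card A - j})" by simp
    moreover have "card ` insert a ` (C - {t}) = Suc ` card ` (C - {t})"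
      unfolding image_image using card_insert by (intro image_cong) auto
    moreover have "{j..card A - j} - {card A - j} = {j..card A - Suc j}" using lt by auto
    ultimately have "card ` insert a ` (C - {t}) = {Suc j..card (insert a A) - Suc j}"
      using assms(1,2) lt by (simp add: image_Suc_atLeastAtMost Suc_diff_Suc)
    moreover have "insert a ` (C - {t}) \<subseteq> Pow (insert a A)"
      using C(1) by auto
    moreover have "S \<subseteq> T \<or> T \<subseteq> S" if "S \<in> insert a ` (C - {t})" "T \<in> insert a ` (C - {t})" for S T
      using that C(2) by (blast intro: insert_mono)
    moreover have "2 * Suc j \<le> card (insert a A)" using lt assms(1,2) by simp
    ultimately show ?thesis
      by (rule symmetric_chainI)
  qed
  show ?thesis using t(1) 1 2 by blast
qed

text \<open>Every chain of the decomposition for \<open>A\<close> is replaced by its long and its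
  short chain. A set containing \<open>a\<close> goes to the long chain if removing \<open>a\<close>
  leaves the top, and to the short chain otherwise; a set without \<open>a\<close> stays in the long
  chain.\<close>

lemma symmetric_chain_decomposition:
  assumes "finite A"
  shows "\<exists>\<C>. \<Union>\<C> = Pow A \<and> (\<forall>C\<in>\<C>. symmetric_chain A C) \<and> 
    (\<forall>C\<in>\<C>. \<forall>D\<in>\<C>. \<forall>S. S \<in> C \<and> S \<in> D \<longrightarrow> C = D)"
  using assms
proof (induction A rule: finite_induct)
  case empty
  have "symmetric_chain {} {{} :: 'a set}" by (auto simp: symmetric_chain_def)
  then show ?case by (intro exI[of _ "{{{}}}"]) auto
next
  case (insert a A)
  obtain \<C> where raw: "\<Union>\<C> = Pow A \<and> (\<forall>C\<in>\<C>. symmetric_chain A C) \<and> 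
    (\<forall>C\<in>\<C>. \<forall>D\<in>\<C>. \<forall>S. S \<in> C \<and> S \<in> D \<longrightarrow> C = D)"
    using insert.IH by (rule exE)
  note \<C> = raw[THEN conjunct1] raw[THEN conjunct2, THEN conjunct1, THEN bspec]
    raw[THEN conjunct2, THEN conjunct2, THEN bspec, THEN bspec, THEN spec, THEN mp, OF _ _ conjI]
  obtain t where t: "\<And>C. C \<in> \<C> \<Longrightarrow> t C \<in> C"
    "\<And>C. C \<in> \<C> \<Longrightarrow> symmetric_chain (insert a A) (insert (insert a (t C)) C)"
    "\<And>C. C \<in> \<C> \<Longrightarrow> C \<noteq> {t C} \<Longrightarrow> symmetric_chain (insert a A) (insert a ` (C - {t C}))"
  proof -
    have "\<forall>C\<in>\<C>. \<exists>t. t \<in> C \<and> symmetric_chain (insert a A) (insert (insert a t) C) \<and>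
        (C \<noteq> {t} \<longrightarrow> symmetric_chain (insert a A) (insert a ` (C - {t})))"
      using symmetric_chain_insert[OF insert.hyps \<C>(2)] by auto
    from bchoice[OF this] show thesis using that by auto
  qed
  have a: "a \<notin> S" if "S \<in> C" "C \<in> \<C>" for S C
    using that \<C>(1) insert.hyps(2) by blast
  define long where "long C = insert (insert a (t C)) C" for C
  define short where "short C = insert a ` (C - {t C})" for C
  define \<D> where "\<D> = long ` \<C> \<union> short ` {C \<in> \<C>. C \<noteq> {t C}}"
  have longD: "S - {a} \<in> C \<and> (a \<in> S \<longrightarrow> S - {a} = t C)" if "S \<in> long C" "C \<in> \<C>" for S C
  proof (cases "S \<in> C")
    case True
    then show ?thesis using a[OF True that(2)] by simp
  next
    case False
    then show ?thesis using that a[OF t(1)[OF that(2)] that(2)] t(1) by (simp add: long_def)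
  qed
  have shortD: "S - {a} \<in> C \<and> a \<in> S \<and> S - {a} \<noteq> t C" if S: "S \<in> short C" "C \<in> \<C>" for S C
  proof -
    obtain T where T: "T \<in> C" "T \<noteq> t C" "S = insert a T" using S(1) by (auto simp: short_def)
    then show ?thesis using a[OF T(1) S(2)] by simp
  qed
  have "\<Union>\<D> = Pow (insert a A)"
  proof
    show "\<Union>\<D> \<subseteq> Pow (insert a A)"
    proof
      fix S assume "S \<in> \<Union>\<D>"
      then obtain C where C: "C \<in> \<C>" "S \<in> long C \<or> S \<in> short C" by (auto simp: \<D>_def)
      then have "S - {a} \<in> C" using longD shortD by metis
      then have "S - {a} \<in> Pow A" unfolding \<C>(1)[symmetric] using C(1) by (rule UnionI[rotated])
      then show "S \<in> Pow (insert a A)" by auto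
    qed
    show "Pow (insert a A) \<subseteq> \<Union>\<D>"
    proof
      fix S assume "S \<in> Pow (insert a A)"
      then have "S - {a} \<in> \<Union>\<C>" using \<C>(1) by auto
      then obtain C where C: "C \<in> \<C>" "S - {a} \<in> C" by auto
      show "S \<in> \<Union>\<D>"
      proof (cases "a \<in> S \<and> S - {a} \<noteq> t C")
        case True
        then have "S \<in> short C" using C(2) unfolding short_def by (auto intro!: rev_image_eqI[of "S - {a}"])
        moreover have "C \<noteq> {t C}" using True C(2) by (metis singletonD)
        ultimately show ?thesis using C(1) by (auto simp: \<D>_def)
      next
        case False
        then have "S \<in> long C" using C(2) unfolding long_def by (cases "a \<in> S") auto
        then show ?thesis using C(1) by (auto simp: \<D>_def)
      qed
    qed
  qed
  moreover have "symmetric_chain (insert a A) D" if "D \<in> \<D>" for D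
    using that t(2,3) by (auto simp: \<D>_def long_def short_def)
  \<comment> \<open>Removing \<open>a\<close> identifies the old chain. Within it, a set lies in the
    short chain only if it contains \<open>a\<close> and the rest is not the top, which excludes the
    long chain.\<close>
  moreover have "D = E" if DE: "D \<in> \<D>" "E \<in> \<D>" and S: "S \<in> D" "S \<in> E" for D E S
  proof -
    obtain C where C: "C \<in> \<C>" "D = long C \<or> D = short C" using DE(1) by (auto simp: \<D>_def)
    obtain C' where C': "C' \<in> \<C>" "E = long C' \<or> E = short C'" using DE(2) by (auto simp: \<D>_def)
    have "S - {a} \<in> C" "S - {a} \<in> C'"
      using C C' S longD shortD by metis+
    then have "C = C'" using \<C>(3) C(1) C'(1) by metis
    then show ?thesis using C C' S longD[of S C] shortD[of S C] by auto
  qed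
  ultimately show ?case by (intro exI[of _ \<D>] conjI ballI allI impI) (simp, simp, metis)
qed

text \<open>Each \<open>k\<close>-set is sent to the \<open>l\<close>-set in its own chain. This
  exists because \<open>j \<le> k \<le> l \<le> card A - k \<le> card A - j\<close> for a chain with
  ranks \<open>j\<close> to \<open>card A - j\<close>. The image determines the chain, and the chain
  contains only one \<open>k\<close>-set.\<close>

lemma subset_matching:
  assumes "finite A" "k \<le> l" "k + l \<le> card A"
  obtains \<phi> where "inj_on \<phi> {S. S \<subseteq> A \<and> card S = k}"
    "\<And>S. S \<subseteq> A \<Longrightarrow> card S = k \<Longrightarrow> S \<subseteq> \<phi> S \<and> \<phi> S \<subseteq> A \<and> card (\<phi> S) = l"
proof -
  obtain \<C> where raw: "\<Union>\<C> = Pow A \<and> (\<forall>C\<in>\<C>. symmetric_chain A C) \<and> 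
    (\<forall>C\<in>\<C>. \<forall>D\<in>\<C>. \<forall>S. S \<in> C \<and> S \<in> D \<longrightarrow> C = D)"
    using symmetric_chain_decomposition[OF assms(1)] by (rule exE)
  note \<C> = raw[THEN conjunct1] raw[THEN conjunct2, THEN conjunct1, THEN bspec]
    raw[THEN conjunct2, THEN conjunct2, THEN bspec, THEN bspec, THEN spec, THEN mp, OF _ _ conjI]
  have "\<exists>T. T \<subseteq> A \<and> S \<subseteq> T \<and> card T = l \<and> (\<exists>C\<in>\<C>. S \<in> C \<and> T \<in> C)"
    if S: "S \<subseteq> A" "card S = k" for S
  proof -
    have "S \<in> \<Union>\<C>" unfolding \<C>(1) using S(1) by simp
    then obtain C where C: "C \<in> \<C>" "S \<in> C" by (rule UnionE)
    obtain j where j: "card ` C = {j..card A - j}" and CA: "C \<subseteq> Pow A"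
      and chain: "\<And>S T. S \<in> C \<Longrightarrow> T \<in> C \<Longrightarrow> S \<subseteq> T \<or> T \<subseteq> S" and "2 * j \<le> card A"
      by (rule symmetric_chainE[OF \<C>(2)[OF C(1)]]) (rule that)
    have "k \<in> {j..card A - j}" unfolding j[symmetric] using C(2) S(2) by (rule rev_image_eqI[OF _ sym])
    then have "l \<in> card ` C" unfolding j using assms(2,3) by auto
    then obtain T where T: "T \<in> C" "card T = l" by auto
    have "T \<subseteq> A" using T(1) CA by auto
    have "S \<subseteq> T"
    proof (rule ccontr)
      assume n: "\<not> S \<subseteq> T"
      then have "T \<subseteq> S" using chain[OF C(2) T(1)] by simp
      then have "T = S"
        using card_seteq[of S T] S T(2) assms(2) finite_subset[OF S(1) assms(1)] by simp
      then show False using n by simp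
    qed
    then show ?thesis using T C \<open>T \<subseteq> A\<close> by blast
  qed
  then obtain \<phi> where \<phi>: "\<And>S. S \<subseteq> A \<Longrightarrow> card S = k \<Longrightarrow>
      \<phi> S \<subseteq> A \<and> S \<subseteq> \<phi> S \<and> card (\<phi> S) = l \<and> (\<exists>C\<in>\<C>. S \<in> C \<and> \<phi> S \<in> C)"
    by metis
  have "inj_on \<phi> {S. S \<subseteq> A \<and> card S = k}"
  proof (rule inj_onI)
    fix S T assume ST: "S \<in> {S. S \<subseteq> A \<and> card S = k}" "T \<in> {S. S \<subseteq> A \<and> card S = k}" "\<phi> S = \<phi> T"
    then obtain C D where CD: "C \<in> \<C>" "S \<in> C" "\<phi> S \<in> C" "D \<in> \<C>" "T \<in> D" "\<phi> S \<in> D"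
      using \<phi>[of S] \<phi>[of T] by auto
    then have "D = C" using \<C>(3) by metis
    then have "S \<subseteq> T \<or> T \<subseteq> S"
      using symmetric_chainE[OF \<C>(2)[OF CD(1)]] CD(2,5) by metis
    then show "S = T"
      using ST assms(1) by (metis (mono_tags, lifting) card_subset_eq finite_subset mem_Collect_eq)
  qed
  then show thesis by (rule that) (use \<phi> in simp)
qed

section \<open>Standardization\<close>

text \<open>An element \<open>m\<close> with the most predecessors is maximal: anything above it
  would have all these predecessors and \<open>m\<close> as well. It receives the last number, and
  the rest is numbered by induction.\<close>

lemma linear_extension:
  assumes "finite N"
    and "\<And>u v w. u \<in> N \<Longrightarrow> v \<in> N \<Longrightarrow> w \<in> N \<Longrightarrow> lt u v \<Longrightarrow> lt v w \<Longrightarrow> lt u w"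
    and "\<And>u. u \<in> N \<Longrightarrow> \<not> lt u u"
  shows "\<exists>p :: 'a \<Rightarrow> nat. bij_betw p N {..<card N} \<and> (\<forall>u\<in>N. \<forall>v\<in>N. lt u v \<longrightarrow> p u < p v)"
  using assms
proof (induction "card N" arbitrary: N)
  case 0
  then show ?case by (auto simp: bij_betw_def)
next
  case (Suc n)
  have "N \<noteq> {}" using Suc.hyps(2) by auto
  then have "Max ((\<lambda>v. card {u\<in>N. lt u v}) ` N) \<in> (\<lambda>v. card {u\<in>N. lt u v}) ` N"
    using Suc.prems(1) by (intro Max_in) auto
  then obtain m where m: "m \<in> N" "card {u\<in>N. lt u m} = Max ((\<lambda>v. card {u\<in>N. lt u v}) ` N)"
    by auto
  have max: "\<not> lt m v" if v: "v \<in> N" for v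
  proof
    assume l: "lt m v"
    have "{u\<in>N. lt u m} \<subset> {u\<in>N. lt u v}"
      using l v m(1) Suc.prems(2,3) by blast
    then have "card {u\<in>N. lt u m} < card {u\<in>N. lt u v}"
      using Suc.prems(1) by (intro psubset_card_mono) auto
    moreover have "card {u\<in>N. lt u v} \<le> card {u\<in>N. lt u m}"
      unfolding m(2) using Suc.prems(1) v by (intro Max_ge) auto
    ultimately show False by simp
  qed
  have c: "card (N - {m}) = n" using Suc.hyps(2) Suc.prems(1) m(1) by simp
  have "\<exists>p :: 'a \<Rightarrow> nat. bij_betw p (N - {m}) {..<card (N - {m})} \<and>
      (\<forall>u\<in>N - {m}. \<forall>v\<in>N - {m}. lt u v \<longrightarrow> p u < p v)"
  proof (rule Suc.hyps(1))
    show "lt u w" if "u \<in> N - {m}" "v \<in> N - {m}" "w \<in> N - {m}" "lt u v" "lt v w" for u v w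
      using Suc.prems(2)[of u v w] that by simp
  qed (use c Suc.prems(1,3) in auto)
  then obtain p :: "'a \<Rightarrow> nat" where p: "bij_betw p (N - {m}) {..<n}"
    "\<forall>u\<in>N - {m}. \<forall>v\<in>N - {m}. lt u v \<longrightarrow> p u < p v"
    unfolding c by (elim exE conjE)
  have "bij_betw (p(m := n)) (N - {m}) {..<n}"
    using p(1) by (rule bij_betw_cong[THEN iffD1, rotated]) simp
  then have "bij_betw (p(m := n)) (insert m (N - {m})) {..<Suc n}"
    unfolding lessThan_Suc using notIn_Un_bij_betw[of m "N - {m}" "p(m := n)" "{..<n}"] by simp
  then have 1: "bij_betw (p(m := n)) N {..<card N}"
    unfolding insert_Diff[OF m(1)] Suc.hyps(2)[symmetric] .
  have "(p(m := n)) u < (p(m := n)) v" if uv: "u \<in> N" "v \<in> N" "lt u v" for u v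
  proof -
    have "u \<noteq> m" using max[OF uv(2)] uv(3) by auto
    then have "p u < n" using p(1) uv(1) by (auto simp: bij_betw_def)
    then show ?thesis using p(2) uv \<open>u \<noteq> m\<close> by auto
  qed
  then show ?case using 1 by blast
qed

lemma bij_betw_initial_segment:
  assumes "finite N" "bij_betw p N {..<card N}" "A \<subseteq> N"
    and lt: "\<And>u w. u \<in> A \<Longrightarrow> w \<in> N - A \<Longrightarrow> p u < (p w :: nat)" and u: "u \<in> N"
  shows "u \<in> A \<longleftrightarrow> p u < card A"
proof
  have inj: "inj_on p A" using assms(2,3) by (auto simp: bij_betw_def intro: inj_on_subset)
  have finA: "finite A" using assms(1,3) finite_subset by auto
  {
    assume uA: "u \<in> A"
    have "{..p u} \<subseteq> p ` A"
    proof
      fix i assume i: "i \<in> {..p u}"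
      have "p u < card N" using bij_betwE[OF assms(2)] u by auto
      then have "i \<in> p ` N" using i unfolding bij_betw_imp_surj_on[OF assms(2)] by simp
      then obtain x where "x \<in> N" "i = p x" by auto
      then show "i \<in> p ` A" using lt[OF uA, of x] i by fastforce
    qed
    then have "card {..p u} \<le> card (p ` A)" using finA by (intro card_mono) auto
    then show "p u < card A" using card_image[OF inj] by simp
  }
  {
    assume "p u < card A"
    show "u \<in> A"
    proof (rule ccontr)
      assume "u \<notin> A"
      then have "p ` A \<subseteq> {..<p u}" using lt u by auto
      then have "card (p ` A) \<le> p u" using card_mono[of "{..<p u}"] by simp
      then show False using \<open>p u < card A\<close> card_image[OF inj] by simp
    qed
  }
qed

lemma rank_image:
  fixes R :: "nat set"
  assumes "finite R"
  shows "(\<lambda>x. card {y\<in>R. y < x}) ` R = {..<card R}"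
    and "\<And>x y. x \<in> R \<Longrightarrow> y \<in> R \<Longrightarrow> card {z\<in>R. z < x} < card {z\<in>R. z < y} \<longleftrightarrow> x < y"
proof -
  have lt: "card {z\<in>R. z < x} < card {z\<in>R. z < y}" if "x \<in> R" "x < y" for x y
    using assms that by (intro psubset_card_mono) auto
  then show iff: "card {z\<in>R. z < x} < card {z\<in>R. z < y} \<longleftrightarrow> x < y" if "x \<in> R" "y \<in> R" for x y
  proof (cases x y rule: linorder_cases)
    case greater
    then show ?thesis using lt[OF that(2) greater] by linarith
  qed (use lt[OF that(1)] in auto)
  have "inj_on (\<lambda>x. card {y\<in>R. y < x}) R"
  proof (rule inj_onI)
    fix x y assume "x \<in> R" "y \<in> R" "card {z\<in>R. z < x} = card {z\<in>R. z < y}"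
    then show "x = y"
      using lt[of x y] lt[of y x] by (cases x y rule: linorder_cases) auto
  qed
  moreover have "card {y\<in>R. y < x} < card R" if "x \<in> R" for x
    using assms that by (intro psubset_card_mono) auto
  ultimately show "(\<lambda>x. card {y\<in>R. y < x}) ` R = {..<card R}"
    by (intro card_subset_eq) (auto simp: card_image)
qed

text \<open>Equivalently, both functions induce the same ordered set partition of
  \<open>N\<close>.\<close>

definition same_order :: "'a set \<Rightarrow> ('a \<Rightarrow> nat) \<Rightarrow> ('a \<Rightarrow> nat) \<Rightarrow> bool" where
  "same_order N f f' \<longleftrightarrow> (\<forall>u\<in>N. \<forall>v\<in>N. f u < f v \<longleftrightarrow> f' u < f' v)"

text \<open>List \<open>N\<close> by increasing value, with positions counted from 1. Every element
  receives the position at which its fibre begins, so the image records the sizes of the fibres in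
  order: it is the type of \<open>f\<close>.\<close>

definition standardize :: "'a set \<Rightarrow> ('a \<Rightarrow> nat) \<Rightarrow> 'a \<Rightarrow> nat" where
  "standardize N f = (\<lambda>v\<in>N. Suc (card {u\<in>N. f u < f v}))"

lemma same_order_le:
  assumes "same_order N f f'" "u \<in> N" "v \<in> N"
  shows "f u \<le> f v \<longleftrightarrow> f' u \<le> f' v"
  using assms unfolding same_order_def by (meson not_le)

lemma same_order_eq:
  assumes "same_order N f f'" "u \<in> N" "v \<in> N"
  shows "f u = f v \<longleftrightarrow> f' u = f' v"
  using same_order_le[OF assms] same_order_le[OF assms(1,3,2)] by (simp add: order_eq_iff)

lemma same_order_standardize:
  assumes "finite N"
  shows "same_order N f (standardize N f)"
  unfolding same_order_def
proof (intro ballI)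
  have lt: "card {x\<in>N. f x < f u} < card {x\<in>N. f x < f v}" if "u \<in> N" "f u < f v" for u v
    using assms that by (intro psubset_card_mono) auto
  fix u v assume uv: "u \<in> N" "v \<in> N"
  show "f u < f v \<longleftrightarrow> standardize N f u < standardize N f v"
  proof (cases "f u" "f v" rule: linorder_cases)
    case greater
    then show ?thesis using lt[OF uv(2) greater] uv by (simp add: standardize_def)
  qed (use lt[OF uv(1)] uv in \<open>auto simp: standardize_def\<close>)
qed

lemma standardize_cong:
  assumes "same_order N f f'"
  shows "standardize N f = standardize N f'"
proof (rule ext)
  fix v
  have "{u\<in>N. f u < f v} = {u\<in>N. f' u < f' v}" if "v \<in> N"
    using assms that by (auto simp: same_order_def)
  then show "standardize N f v = standardize N f' v" by (simp add: standardize_def)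
qed

text \<open>For finite \<open>N\<close> these are canonical representatives of the classes of
  \<open>same_order\<close>, one for each ordered set partition of \<open>N\<close>.\<close>

definition standardized :: "'a set \<Rightarrow> ('a \<Rightarrow> nat) set" where
  "standardized N = {r \<in> N \<rightarrow>\<^sub>E {1..}. standardize N r = r}"

lemma standardize_in_standardized:
  assumes "finite N"
  shows "standardize N f \<in> standardized N"
  using standardize_cong[OF same_order_standardize[OF assms, of f]]
  by (auto simp: standardized_def) (auto simp: standardize_def)

lemma standardizedD:
  assumes "r \<in> standardized N" "v \<in> N"
  shows "r v = Suc (card {u\<in>N. r u < r v})"
proof -
  have "standardize N r = r" using assms(1) by (simp add: standardized_def)
  then have "r v = standardize N r v" by (rule fun_cong[OF sym])
  then show ?thesis using assms(2) by (simp add: standardize_def)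
qed

lemma standardized_le_card:
  assumes "finite N" "r \<in> standardized N" "v \<in> N"
  shows "r v \<in> {1..card N}"
proof -
  have *: "card {u\<in>N. r u < r v} < card N"
    using assms(1,3) by (intro psubset_card_mono) auto
  show ?thesis using * standardizedD[OF assms(2,3)] by simp
qed

text \<open>An order isomorphism of a set of naturals onto itself is the identity. If the values at
  \<open>v\<close> differed, the smaller of them would be attained by the other function at a point
  where induction already gives equality, against \<open>same_order\<close>.\<close>

lemma same_order_image_eq:
  assumes "same_order N f f'" "f ` N = f' ` N" "v \<in> N"
  shows "f v = f' v"
  using assms(3)
proof (induction "f v" arbitrary: v rule: less_induct)
  case less
  have iff: "f u < f w \<longleftrightarrow> f' u < f' w" if "u \<in> N" "w \<in> N" for u w
    using assms(1) that by (simp add: same_order_def)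
  have "\<not> f' v < f v"
  proof
    assume l: "f' v < f v"
    have "f' v \<in> f ` N" unfolding assms(2) using less.prems by (rule imageI)
    then obtain w where w: "w \<in> N" "f w = f' v" by auto
    then show False using less.hyps[of w] iff[OF w(1) less.prems] l by simp
  qed
  moreover have "\<not> f v < f' v"
  proof
    assume l: "f v < f' v"
    have "f v \<in> f' ` N" unfolding assms(2)[symmetric] using less.prems by (rule imageI)
    then obtain u where u: "u \<in> N" "f' u = f v" by auto
    then show False using less.hyps[of u] iff[OF u(1) less.prems] l by simp
  qed
  ultimately show ?case by simp
qed

text \<open>An ordered set partition together with a set of as many values as blocks determines the
  function. The inverse map replaces the smallest value of \<open>r\<close> by the smallest element
  of \<open>A\<close>, and so on upwards.\<close>

lemma bij_betw_standardize:
  assumes "finite N" "finite A" "A \<subseteq> {1..}"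
  shows "bij_betw (standardize N) {f \<in> N \<rightarrow>\<^sub>E {1..}. f ` N = A} {r \<in> standardized N. card (r ` N) = card A}"
  unfolding bij_betw_def
proof
  show "inj_on (standardize N) {f \<in> N \<rightarrow>\<^sub>E {1..}. f ` N = A}"
  proof (rule inj_onI)
    fix f f' assume f: "f \<in> {f \<in> N \<rightarrow>\<^sub>E {1..}. f ` N = A}" "f' \<in> {f \<in> N \<rightarrow>\<^sub>E {1..}. f ` N = A}"
      and eq: "standardize N f = standardize N f'"
    have "same_order N f f'"
      using same_order_standardize[OF assms(1), of f] same_order_standardize[OF assms(1), of f'] eq
      by (simp add: same_order_def)
    then have "f v = f' v" if "v \<in> N" for v
      using same_order_image_eq[OF _ _ that] f by simp
    then show "f = f'" using f by (intro PiE_ext[of f N "\<lambda>_. {1..}"]) auto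
  qed
  show "standardize N ` {f \<in> N \<rightarrow>\<^sub>E {1..}. f ` N = A} = {r \<in> standardized N. card (r ` N) = card A}"
  proof (intro equalityI subsetI)
    fix r assume "r \<in> standardize N ` {f \<in> N \<rightarrow>\<^sub>E {1..}. f ` N = A}"
    then obtain f where f: "f ` N = A" "r = standardize N f" by auto
    have eq: "r u = r v \<longleftrightarrow> f u = f v" if "u \<in> N" "v \<in> N" for u v
      using same_order_eq[OF same_order_standardize[OF assms(1), of f] that] f(2) by simp
    \<comment> \<open>Standardization neither identifies nor separates values, so the values of
      \<open>f\<close> and of \<open>r\<close> correspond one to one.\<close>
    have "bij_betw (\<lambda>x. r (SOME u. u \<in> N \<and> f u = x)) (f ` N) (r ` N)"
    proof -
      have e: "r (SOME w. w \<in> N \<and> f w = f u) = r u" if "u \<in> N" for u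
        using someI[of "\<lambda>w. w \<in> N \<and> f w = f u" u] that eq by auto
      show ?thesis
        unfolding bij_betw_def using e eq by (auto intro!: inj_onI simp: image_iff)
    qed
    then have "card (r ` N) = card A" using f(1) by (simp add: bij_betw_same_card)
    then show "r \<in> {r \<in> standardized N. card (r ` N) = card A}"
      using standardize_in_standardized[OF assms(1)] f(2) by simp
  next
    fix r assume "r \<in> {r \<in> standardized N. card (r ` N) = card A}"
    then have r: "r \<in> standardized N" "card (r ` N) = card A" by auto
    define L where "L = sorted_list_of_set A"
    have L: "sorted_wrt (<) L" "set L = A" "length L = card A"
      using assms(2) by (auto simp: L_def)
    have nth: "L ! i < L ! j \<longleftrightarrow> i < j" if "i < card A" "j < card A" for i j
      using that L(3) sorted_wrt_nth_less[OF L(1), of i j] sorted_wrt_nth_less[OF L(1), of j i]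
      by (cases i j rule: linorder_cases) auto
    define c where "c v = card {y\<in>r ` N. y < r v}" for v
    have finR: "finite (r ` N)" using assms(1) by simp
    have c: "c ` N = {..<card A}"
      using rank_image(1)[OF finR] r(2) by (simp add: c_def image_image)
    define f where "f = (\<lambda>v\<in>N. L ! c v)"
    have cA: "c v < card A" if "v \<in> N" for v using c that by blast
    have fA: "f ` N = A"
    proof -
      have "f ` N = (!) L ` c ` N" by (auto simp: f_def)
      also have "\<dots> = A" unfolding c using L by (auto simp: set_conv_nth)
      finally show ?thesis .
    qed
    have so: "same_order N f r"
      unfolding same_order_def
    proof (intro ballI)
      fix u v assume uv: "u \<in> N" "v \<in> N"
      show "f u < f v \<longleftrightarrow> r u < r v"
        using nth[OF cA cA, OF uv] rank_image(2)[OF finR, of "r u" "r v"] uv by (simp add: f_def c_def)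
    qed
    have "f \<in> N \<rightarrow>\<^sub>E {1..}"
      using fA assms(3) by (auto simp: f_def PiE_iff extensional_def)
    moreover have "standardize N f = r"
      using standardize_cong[OF so] r(1) by (simp add: standardized_def)
    ultimately show "r \<in> standardize N ` {f \<in> N \<rightarrow>\<^sub>E {1..}. f ` N = A}"
      using fA by blast
  qed
qed

section \<open>Order-invariant families of functions\<close>

text \<open>
  The functions \<open>f\<close> satisfying \<open>P\<close> abstract from \<open>D\<close>-partitions and from colorings with \<open>k\<close> ascents.
  By \<open>refinable\<close>, such an \<open>f\<close> can be refined along a suitable linear order \<open>p\<close> of \<open>N\<close>: splitting
  its fibres arbitrarily into intervals of \<open>p\<close> stays within \<open>P\<close>.
\<close>

locale order_family =
  fixes N :: "'a set" and \<Gamma> :: "('a \<Rightarrow> 'a) set" and P :: "('a \<Rightarrow> nat) \<Rightarrow> bool"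
  assumes finite_N: "finite N"
    and \<Gamma>: "subgroup \<Gamma> (BijGroup N)"
    and P_same_order: "same_order N f f' \<Longrightarrow> P f \<longleftrightarrow> P f'"
    and P_invariant: "g \<in> \<Gamma> \<Longrightarrow> P (\<lambda>v. f (g v)) \<longleftrightarrow> P f"
    and refinable: "P f \<Longrightarrow> \<exists>p. bij_betw p N {..<card N} \<and> (\<forall>u\<in>N. \<forall>v\<in>N. f u < f v \<longrightarrow> p u < p v) \<and>
      (\<forall>h. (\<forall>u\<in>N. \<forall>v\<in>N. (p u \<le> p v \<longrightarrow> h u \<le> h v) \<and> (f u < f v \<longrightarrow> h u < h v)) \<longrightarrow> P h)"
begin

abbreviation "group_\<Gamma> \<equiv> (BijGroup N)\<lparr>carrier := \<Gamma>\<rparr>"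

definition act :: "('a \<Rightarrow> 'a) \<Rightarrow> ('a \<Rightarrow> nat) \<Rightarrow> 'a \<Rightarrow> nat" where
  "act g r = (\<lambda>v\<in>N. r (g v))"

text \<open>The admissible functions of type \<open>S\<close>, represented by their
  standardizations.\<close>

definition packed :: "nat set \<Rightarrow> ('a \<Rightarrow> nat) set" where
  "packed S = {r \<in> standardized N. P r \<and> r ` N = S}"

text \<open>The permutation character of the action on \<open>packed S\<close>.\<close>

definition fixed_packed :: "nat set \<Rightarrow> ('a \<Rightarrow> 'a) \<Rightarrow> nat" where
  "fixed_packed S g = card {r \<in> packed S. act g r = r}"

lemma group_group_\<Gamma>: "group group_\<Gamma>"
  using \<Gamma> group_BijGroup by (rule subgroup.subgroup_is_group)

lemma \<Gamma>_bij: "g \<in> \<Gamma> \<Longrightarrow> bij_betw g N N"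
  using subgroup.subset[OF \<Gamma>] by (auto simp: BijGroup_def Bij_def)

lemma finite_standardized: "finite (standardized N)"
proof (rule finite_subset)
  show "standardized N \<subseteq> N \<rightarrow>\<^sub>E {1..card N}"
  proof
    fix r assume r: "r \<in> standardized N"
    then have "r \<in> extensional N" by (simp add: standardized_def PiE_iff)
    then show "r \<in> N \<rightarrow>\<^sub>E {1..card N}"
      using standardized_le_card[OF finite_N r] by (simp add: PiE_iff)
  qed
qed (use finite_N in \<open>simp add: finite_PiE\<close>)

lemma finite_packed: "finite (packed S)"
  using finite_standardized by (rule rev_finite_subset) (auto simp: packed_def)

lemma standardized_eqI:
  assumes "r \<in> N \<rightarrow>\<^sub>E {1..}" "\<And>v. v \<in> N \<Longrightarrow> r v = Suc (card {u\<in>N. r u < r v})"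
  shows "r \<in> standardized N"
proof -
  have "standardize N r = r"
  proof
    fix v show "standardize N r v = r v"
    proof (cases "v \<in> N")
      case True
      then show ?thesis using assms(2)[OF True, symmetric] by (simp add: standardize_def)
    next
      case False
      then show ?thesis using PiE_arb[OF assms(1) False] by (simp add: standardize_def)
    qed
  qed
  then show ?thesis using assms(1) by (simp add: standardized_def)
qed

lemma act_packed:
  assumes "g \<in> \<Gamma>" "r \<in> packed S"
  shows "act g r \<in> packed S"
proof -
  have bij: "bij_betw g N N" by (rule \<Gamma>_bij[OF assms(1)])
  have gN: "g v \<in> N" if "v \<in> N" for v using bij_betwE[OF bij] that by simp
  have r: "r \<in> standardized N" "P r" "r ` N = S" using assms(2) by (auto simp: packed_def)
  have "act g r \<in> N \<rightarrow>\<^sub>E {1..}"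
    using r(1) gN by (auto simp: act_def standardized_def PiE_iff)
  moreover have "act g r v = Suc (card {u\<in>N. act g r u < act g r v})" if v: "v \<in> N" for v
  proof -
    have "bij_betw g {u\<in>N. act g r u < act g r v} {w\<in>N. r w < r (g v)}"
      by (rule bij_betw_Collect[OF bij]) (use v in \<open>simp add: act_def\<close>)
    then have "card {u\<in>N. act g r u < act g r v} = card {w\<in>N. r w < r (g v)}"
      by (rule bij_betw_same_card)
    then show ?thesis
      using standardizedD[OF r(1) gN[OF v]] v by (simp add: act_def)
  qed
  ultimately have "act g r \<in> standardized N" by (rule standardized_eqI)
  moreover have "P (act g r)"
    using P_same_order[of "act g r" "\<lambda>v. r (g v)"] P_invariant[OF assms(1)] r(2)
    by (simp add: same_order_def act_def)
  moreover have "act g r ` N = S"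
  proof -
    have "act g r ` N = r ` g ` N" by (auto simp: act_def)
    then show ?thesis unfolding bij_betw_imp_surj_on[OF bij] r(3) .
  qed
  ultimately show ?thesis by (simp add: packed_def)
qed

lemma right_action_packed: "right_action group_\<Gamma> (packed S) act"
  unfolding right_action_def
proof (intro conjI ballI)
  fix r assume r: "r \<in> packed S"
  then have ext: "r \<in> extensional N" by (auto simp: packed_def standardized_def PiE_def)
  show "act \<one>\<^bsub>group_\<Gamma>\<^esub> r = r"
    using ext by (auto simp: act_def BijGroup_def extensional_def)
  fix g assume g: "g \<in> carrier group_\<Gamma>"
  then show "act g r \<in> packed S" using act_packed r by simp
  fix h assume h: "h \<in> carrier group_\<Gamma>"
  have "g \<in> Bij N" "h \<in> Bij N" using g h subgroup.subset[OF \<Gamma>] by (auto simp: BijGroup_def)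
  moreover have "h v \<in> N" if "v \<in> N" for v
    using bij_betwE[OF \<Gamma>_bij] h that by simp
  ultimately show "act (g \<otimes>\<^bsub>group_\<Gamma>\<^esub> h) r = act h (act g r)"
    by (auto simp: act_def BijGroup_def compose_def)
qed

text \<open>Nothing lies below the least value, so standardization makes it 1. For nonempty
  \<open>N\<close>, \<open>packed S\<close> is thus empty unless \<open>1 \<in> S\<close>, and in
  the relevant cases there is always an element to round down to.\<close>

lemma one_in_packed:
  assumes "r \<in> packed S" "N \<noteq> {}"
  shows "1 \<in> S"
proof -
  have "Min (r ` N) \<in> r ` N" using finite_N assms(2) by (intro Min_in) auto
  then obtain v where v: "v \<in> N" "r v = Min (r ` N)" by auto
  have empty: "{u\<in>N. r u < r v} = {}" unfolding v(2) using Min_le[of "r ` N"] finite_N by (force simp: not_less[symmetric])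
  have "r \<in> standardized N" using assms(1) by (simp add: packed_def)
  then have "r v = 1" using standardizedD[of r N v] v(1) unfolding empty by simp
  then have "1 \<in> r ` N" using v(1) by (metis imageI)
  then show ?thesis using assms(1) by (simp add: packed_def)
qed

text \<open>This is merging: values of a standardized function are starting positions of blocks, and
  a union of consecutive blocks starts where its first block does. If no element of \<open>S\<close>
  qualifies, the value is unspecified, but it still depends on \<open>r v\<close> alone, which
  suffices for equivariance.\<close>

definition round_down :: "nat set \<Rightarrow> ('a \<Rightarrow> nat) \<Rightarrow> 'a \<Rightarrow> nat" where
  "round_down S r = (\<lambda>v\<in>N. Max {s\<in>S. s \<le> r v})"

text \<open>List \<open>N\<close> in the order \<open>p\<close> supplied by \<open>refinable\<close>
  and cut this list at the positions in \<open>T\<close>. As \<open>S \<subseteq> T\<close>, the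
  cuts include all starts of blocks of \<open>r\<close>, so the resulting \<open>h\<close> refines
  \<open>r\<close>, and rounding it down to \<open>S\<close> gives back \<open>r\<close>.\<close>

lemma packed_subset_round_down:
  assumes "S \<subseteq> T" "T \<subseteq> {1..card N}"
  shows "packed S \<subseteq> round_down S ` packed T"
proof
  fix r assume r: "r \<in> packed S"
  then have rP: "P r" and rN: "r ` N = S" and rstd: "r \<in> standardized N" by (auto simp: packed_def)
  from refinable[OF rP] obtain p where p: "bij_betw p N {..<card N}"
    and mono: "\<And>u v. u \<in> N \<Longrightarrow> v \<in> N \<Longrightarrow> r u < r v \<Longrightarrow> p u < p v"
    and ref: "\<And>h. \<lbrakk>\<And>u v. u \<in> N \<Longrightarrow> v \<in> N \<Longrightarrow> p u \<le> p v \<Longrightarrow> h u \<le> h v;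
      \<And>u v. u \<in> N \<Longrightarrow> v \<in> N \<Longrightarrow> r u < r v \<Longrightarrow> h u < h v\<rbrakk> \<Longrightarrow> P h"
    by auto
  have finT: "finite T" using assms(2) finite_subset by auto
  have one: "1 \<in> T" if "v \<in> N" for v using one_in_packed[OF r] that assms(1) by auto
  \<comment> \<open>\<open>p\<close> counts from 0, whereas types are positions counted from
    1.\<close>
  define q where "q v = Suc (p v)" for v
  define h where "h = round_down T q"
  have hv: "h v \<in> T" "h v \<le> q v" if v: "v \<in> N" for v
  proof -
    have "Max {t\<in>T. t \<le> q v} \<in> {t\<in>T. t \<le> q v}"
      using finT one[OF v] by (intro Max_in) (auto simp: q_def)
    then show "h v \<in> T" "h v \<le> q v" using v by (auto simp: h_def round_down_def)
  qed
  have le_h: "t \<le> h v \<longleftrightarrow> t \<le> q v" if v: "v \<in> N" and t: "t \<in> T" for v t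
  proof
    assume "t \<le> q v"
    then have "t \<le> Max {t\<in>T. t \<le> q v}" using finT t by (intro Max_ge) auto
    then show "t \<le> h v" using v by (simp add: h_def round_down_def)
  qed (use hv[OF v] in linarith)
  \<comment> \<open>The elements of value below \<open>r v\<close> come first in \<open>p\<close>,
    and there are \<open>r v - 1\<close> of them because \<open>r\<close> is standardized. So
    \<open>r v\<close> is the position at which the block of \<open>v\<close> begins.\<close>
  have key: "r u < r v \<longleftrightarrow> q u < r v" if uv: "u \<in> N" "v \<in> N" for u v
  proof -
    have "u \<in> {u\<in>N. r u < r v} \<longleftrightarrow> p u < card {u\<in>N. r u < r v}"
    proof (rule bij_betw_initial_segment[OF finite_N p])
      fix a b assume "a \<in> {u\<in>N. r u < r v}" "b \<in> N - {u\<in>N. r u < r v}"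
      then show "p a < p b" by (intro mono) auto
    qed (use uv in auto)
    then have "r u < r v \<longleftrightarrow> q u < Suc (card {u\<in>N. r u < r v})"
      using uv(1) by (simp add: q_def)
    then show ?thesis unfolding standardizedD[OF rstd uv(2), symmetric] .
  qed
  have rT: "r v \<in> T" if "v \<in> N" for v using rN assms(1) that by auto
  have r_le_h: "r v \<le> h v" if "v \<in> N" for v
    using le_h[OF that rT[OF that]] key[OF that that] by simp
  have "h v \<in> {1..}" if "v \<in> N" for v
    using subsetD[OF assms(2) hv(1)[OF that]] by simp
  moreover have "h \<in> extensional N" by (simp add: h_def round_down_def)
  ultimately have "h \<in> N \<rightarrow>\<^sub>E {1..}" by (simp add: PiE_iff)
  \<comment> \<open>As \<open>h v\<close> lies in \<open>T\<close>, \<open>h u < h v\<close> means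
    that the position of \<open>u\<close> is below \<open>h v\<close>. Exactly
    \<open>h v - 1\<close> positions qualify, since \<open>h v \<le> card N\<close>.\<close>
  moreover have "h v = Suc (card {u\<in>N. h u < h v})" if v: "v \<in> N" for v
  proof -
    have hT: "h v \<in> {1..card N}" using hv(1)[OF v] assms(2) by auto
    have "bij_betw p {u\<in>N. h u < h v} {i\<in>{..<card N}. i < h v - 1}"
    proof (rule bij_betw_Collect[OF p])
      fix u assume "u \<in> N"
      then show "p u < h v - 1 \<longleftrightarrow> h u < h v"
        using le_h[OF _ hv(1)[OF v], of u] hT by (auto simp: q_def)
    qed
    then have "card {u\<in>N. h u < h v} = card {i\<in>{..<card N}. i < h v - 1}"
      by (rule bij_betw_same_card)
    also have "{i\<in>{..<card N}. i < h v - 1} = {..<h v - 1}" using hT by auto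
    finally show ?thesis using hT by simp
  qed
  ultimately have "h \<in> standardized N" by (rule standardized_eqI)
  moreover have "P h"
  proof (rule ref)
    fix u v assume uv: "u \<in> N" "v \<in> N"
    show "h u \<le> h v" if "p u \<le> p v"
      using le_h[OF uv(2) hv(1)[OF uv(1)]] hv(2)[OF uv(1)] that by (simp add: q_def)
    show "h u < h v" if "r u < r v"
      using key[OF uv] that hv(2)[OF uv(1)] r_le_h[OF uv(2)] by linarith
  qed
  moreover have "h ` N = T"
  proof
    show "h ` N \<subseteq> T" using hv(1) by auto
    \<comment> \<open>Every \<open>t\<close> in \<open>T\<close> is itself the position of some
      element, and rounding leaves it unchanged.\<close>
    show "T \<subseteq> h ` N"
    proof
      fix t assume t: "t \<in> T"
      then have "t - 1 \<in> p ` N" "1 \<le> t"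
        unfolding bij_betw_imp_surj_on[OF p] using assms(2) by force+
      then obtain v where v: "v \<in> N" "q v = t" by (auto simp: q_def)
      then have "h v = t" using le_h[OF v(1) t] hv(2)[OF v(1)] by simp
      then show "t \<in> h ` N" using v(1) by auto
    qed
  qed
  ultimately have "h \<in> packed T" by (simp add: packed_def)
  moreover have "r = round_down S h"
  proof
    fix v
    show "r v = round_down S h v"
    proof (cases "v \<in> N")
      case v: True
      \<comment> \<open>A value \<open>r w\<close> above \<open>r v\<close> starts after the
        position of \<open>v\<close> by \<open>key\<close>, so it exceeds \<open>q v\<close> and
        with it \<open>h v\<close>.\<close>
      have "Max {s\<in>S. s \<le> h v} = r v"
      proof (rule Max_eqI)
        show "finite {s\<in>S. s \<le> h v}" by simp
        show "r v \<in> {s\<in>S. s \<le> h v}" using r_le_h[OF v] rN v by auto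
        fix s assume "s \<in> {s\<in>S. s \<le> h v}"
        then obtain w where w: "w \<in> N" "s = r w" "r w \<le> h v" using rN by auto
        then show "s \<le> r v" using key[OF v w(1)] hv(2)[OF v] by linarith
      qed
      then show ?thesis using v by (simp add: round_down_def)
    next
      case False
      then show ?thesis using rstd by (auto simp: round_down_def standardized_def)
    qed
  qed
  ultimately show "r \<in> round_down S ` packed T" by blast
qed

lemma fixed_packed_le:
  assumes "S \<subseteq> T" "T \<subseteq> {1..card N}"
  shows "character_le group_\<Gamma> (\<lambda>g. of_nat (fixed_packed S g)) (\<lambda>g. of_nat (fixed_packed T g))"
  unfolding fixed_packed_def
proof (rule permutation_character_le_partial[OF group_group_\<Gamma> finite_packed right_action_packed
      finite_packed right_action_packed packed_subset_round_down[OF assms]])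
  fix g r assume "g \<in> carrier group_\<Gamma>"
  then have "g v \<in> N" if "v \<in> N" for v using bij_betwE[OF \<Gamma>_bij] that by simp
  then show "round_down S (act g r) = act g (round_down S r)"
    by (auto simp: round_down_def act_def)
qed

lemma effective_fixed_packed: "effective_character group_\<Gamma> (\<lambda>g. of_nat (fixed_packed S g))"
  unfolding fixed_packed_def
  by (rule permutation_character_effective[OF group_group_\<Gamma> finite_packed right_action_packed])

lemma class_function_fixed_packed: "class_function group_\<Gamma> (fixed_packed S)"
  unfolding fixed_packed_def
  by (rule class_function_card_fixed[OF group_group_\<Gamma> finite_packed right_action_packed])

end

lemma class_function_comp: "class_function G f \<Longrightarrow> class_function G (\<lambda>g. h (f g))"
  by (simp add: class_function_def)

lemma class_function_sum:
  assumes "\<And>a. a \<in> A \<Longrightarrow> class_function G (f a)"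
  shows "class_function G (\<lambda>g. \<Sum>a\<in>A. f a g)"
  using assms unfolding class_function_def by (auto intro!: sum.cong)

section \<open>Counting fixed functions by their value sets\<close>

context order_family
begin

lemma P_standardize: "P (standardize N f) \<longleftrightarrow> P f"
  using P_same_order[OF same_order_standardize[OF finite_N]] by simp

text \<open>Invariance under \<open>g\<close> depends only on which values coincide, and
  standardization preserves this.\<close>

lemma standardize_fixed_iff:
  assumes "g \<in> \<Gamma>"
  shows "act g (standardize N f) = standardize N f \<longleftrightarrow> (\<forall>v\<in>N. f (g v) = f v)"
proof -
  have "g v \<in> N" if "v \<in> N" for v using bij_betwE[OF \<Gamma>_bij[OF assms]] that by simp
  then have "(\<forall>v\<in>N. f (g v) = f v) \<longleftrightarrow> (\<forall>v\<in>N. standardize N f (g v) = standardize N f v)"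
    using same_order_eq[OF same_order_standardize[OF finite_N, of f]] by blast
  moreover have "act g (standardize N f) = standardize N f \<longleftrightarrow>
      (\<forall>v\<in>N. act g (standardize N f) v = standardize N f v)"
    by (intro iffI extensionalityI[of _ N]) (auto simp: act_def standardize_def)
  ultimately show ?thesis by (simp add: act_def)
qed

text \<open>The free condition \<open>K\<close> serves two counts: it is trivial for the f-vector,
  and it prescribes the type for the coefficient of a monomial.\<close>

lemma card_fixed_eq_card_standardized:
  assumes g: "g \<in> \<Gamma>" and A: "finite A" "A \<subseteq> {1..}"
  shows "card {f \<in> functions_fixed_by N g. P f \<and> f ` N = A \<and> K (standardize N f)} =
    card {r \<in> standardized N. P r \<and> act g r = r \<and> card (r ` N) = card A \<and> K r}"
proof -
  have "bij_betw (standardize N)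
      {f \<in> {f \<in> N \<rightarrow>\<^sub>E {1..}. f ` N = A}. (\<forall>v\<in>N. f (g v) = f v) \<and> P f \<and> K (standardize N f)}
      {r \<in> {r \<in> standardized N. card (r ` N) = card A}. act g r = r \<and> P r \<and> K r}"
    by (rule bij_betw_Collect[OF bij_betw_standardize[OF finite_N A]])
      (simp add: standardize_fixed_iff[OF g] P_standardize)
  then have "card {f \<in> {f \<in> N \<rightarrow>\<^sub>E {1..}. f ` N = A}. (\<forall>v\<in>N. f (g v) = f v) \<and> P f \<and> K (standardize N f)}
      = card {r \<in> {r \<in> standardized N. card (r ` N) = card A}. act g r = r \<and> P r \<and> K r}"
    by (rule bij_betw_same_card)
  then show ?thesis
    by (simp add: functions_fixed_by_def conj_ac)
qed

definition f_vector :: "nat \<Rightarrow> ('a \<Rightarrow> 'a) \<Rightarrow> nat" where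
  "f_vector i g = (\<Sum>S | S \<subseteq> {1..card N} \<and> card S = i. fixed_packed S g)"

lemma card_standardized_eq_f_vector:
  "card {r \<in> standardized N. P r \<and> act g r = r \<and> card (r ` N) = i} = f_vector i g"
proof -
  let ?R = "{r \<in> standardized N. P r \<and> act g r = r \<and> card (r ` N) = i}"
  let ?T = "{S. S \<subseteq> {1..card N} \<and> card S = i}"
  have "(\<Sum>S\<in>?T. \<Sum>r\<in>{r\<in>?R. r ` N = S}. 1) = (\<Sum>r\<in>?R. 1 :: nat)"
  proof (rule sum.group)
    show "finite ?R" using finite_standardized by simp
    show "finite ?T" by simp
    show "(\<lambda>r. r ` N) ` ?R \<subseteq> ?T" using standardized_le_card[OF finite_N] by blast
  qed
  moreover have "{r\<in>?R. r ` N = S} = {r \<in> packed S. act g r = r}" if "S \<in> ?T" for S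
    using that by (auto simp: packed_def)
  ultimately show ?thesis
    by (simp add: f_vector_def fixed_packed_def)
qed

text \<open>Functions are grouped by their value set \<open>A\<close>. Their number depends on
  \<open>A\<close> only through its size \<open>i\<close>, and there are \<open>n choose i\<close>
  such sets.\<close>

lemma card_bounded_fixed:
  assumes g: "g \<in> \<Gamma>"
  shows "card {f \<in> functions_fixed_by N g. P f \<and> f ` N \<subseteq> {1..n}} = (\<Sum>i\<le>card N. f_vector i g * (n choose i))"
proof -
  let ?F = "{f \<in> functions_fixed_by N g. P f \<and> f ` N \<subseteq> {1..n}}"
  have "finite ?F"
  proof (rule finite_subset)
    show "?F \<subseteq> N \<rightarrow>\<^sub>E {1..n}" by (auto simp: functions_fixed_by_def PiE_def Pi_def)
  qed (use finite_N in \<open>simp add: finite_PiE\<close>)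
  then have "(\<Sum>A\<in>Pow {1..n}. \<Sum>f\<in>{f\<in>?F. f ` N = A}. 1) = (\<Sum>f\<in>?F. 1 :: nat)"
    by (intro sum.group) auto
  moreover have "card {f\<in>?F. f ` N = A} = f_vector (card A) g" if A: "A \<in> Pow {1..n}" for A
  proof -
    have "{f\<in>?F. f ` N = A} = {f \<in> functions_fixed_by N g. P f \<and> f ` N = A \<and> True}"
      using A by auto
    moreover have "finite A" "A \<subseteq> {1..}" using A by (auto intro: finite_subset)
    ultimately show ?thesis
      using card_fixed_eq_card_standardized[OF g, of A "\<lambda>_. True"] card_standardized_eq_f_vector[of g "card A"]
      by simp
  qed
  ultimately have "card ?F = (\<Sum>A\<in>Pow {1..n}. f_vector (card A) g)" by simp
  \<comment> \<open>The bound \<open>n + card N\<close> exceeds both the sizes of subsets of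
    \<open>{1..n}\<close> and the final range; terms beyond \<open>card N\<close> vanish because
    \<open>{1..card N}\<close> has no subsets that large.\<close>
  also have "\<dots> = (\<Sum>i\<le>n + card N. \<Sum>A\<in>{A\<in>Pow {1..n}. card A = i}. f_vector (card A) g)"
  proof (rule sum.group[symmetric])
    show "card ` Pow {1..n} \<subseteq> {..n + card N}"
      using card_mono[of "{1..n}"] by (fastforce intro: trans_le_add1)
  qed auto
  also have "\<dots> = (\<Sum>i\<le>n + card N. f_vector i g * (n choose i))"
    by (intro sum.cong) (simp_all add: n_subsets Pow_def)
  also have "\<dots> = (\<Sum>i\<le>card N. f_vector i g * (n choose i))"
  proof (rule sum.mono_neutral_right)
    have "f_vector i g = 0" if "i > card N" for i
    proof -
      have none: "{S. S \<subseteq> {1..card N} \<and> card S = i} = {}"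
        using card_mono[of "{1..card N}"] that by (auto simp: not_le[symmetric])
      show ?thesis unfolding f_vector_def none by simp
    qed
    then show "\<forall>i\<in>{..n + card N} - {..card N}. f_vector i g * (n choose i) = 0" by simp
  qed auto
  finally show ?thesis .
qed

lemma class_function_f_vector: "class_function group_\<Gamma> (f_vector i)"
  unfolding f_vector_def by (intro class_function_sum class_function_fixed_packed)

text \<open>The difference splits into one effective difference for each matched pair
  \<open>S \<subseteq> \<phi> S\<close>, plus the permutation characters of the unmatched
  \<open>j\<close>-subsets.\<close>

lemma f_vector_le:
  assumes "i \<le> j" "i + j \<le> card N"
  shows "character_le group_\<Gamma> (\<lambda>g. of_nat (f_vector i g)) (\<lambda>g. of_nat (f_vector j g))"
proof -
  let ?A = "{S. S \<subseteq> {1..card N} \<and> card S = i}" and ?B = "{S. S \<subseteq> {1..card N} \<and> card S = j}"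
  obtain \<phi> where inj: "inj_on \<phi> ?A"
    and \<phi>: "\<And>S. S \<subseteq> {1..card N} \<Longrightarrow> card S = i \<Longrightarrow> S \<subseteq> \<phi> S \<and> \<phi> S \<subseteq> {1..card N} \<and> card (\<phi> S) = j"
    using subset_matching[of "{1..card N}" i j] assms by auto
  have finB: "finite ?B" by simp
  have "of_nat (f_vector j g) - of_nat (f_vector i g) =
      (\<Sum>S\<in>?A. of_nat (fixed_packed (\<phi> S) g) - of_nat (fixed_packed S g)) +
      (\<Sum>T\<in>?B - \<phi> ` ?A. of_nat (fixed_packed T g) :: complex)" for g
  proof -
    have "\<phi> ` ?A \<subseteq> ?B" using \<phi> by auto
    then have "f_vector j g = (\<Sum>T\<in>?B - \<phi> ` ?A. fixed_packed T g) + (\<Sum>T\<in>\<phi> ` ?A. fixed_packed T g)"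
      unfolding f_vector_def by (rule sum.subset_diff[OF _ finB])
    also have "(\<Sum>T\<in>\<phi> ` ?A. fixed_packed T g) = (\<Sum>S\<in>?A. fixed_packed (\<phi> S) g)"
      unfolding sum.reindex[OF inj] o_def ..
    finally show ?thesis by (simp add: f_vector_def sum_subtractf)
  qed
  moreover have "effective_character group_\<Gamma> (\<lambda>g. (\<Sum>S\<in>?A. of_nat (fixed_packed (\<phi> S) g) - of_nat (fixed_packed S g)) +
      (\<Sum>T\<in>?B - \<phi> ` ?A. of_nat (fixed_packed T g)))"
    using \<phi> fixed_packed_le[unfolded character_le_def] effective_fixed_packed
    by (intro effective_character_add effective_character_sum) auto
  ultimately show ?thesis unfolding character_le_def by (simp only:)
qed

definition f_poly :: "('a \<Rightarrow> 'a) \<Rightarrow> complex poly" where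
  "f_poly g = (\<Sum>i\<le>card N. Polynomial.smult (of_nat (f_vector i g)) (binomial_poly i))"

lemma poly_f_poly:
  assumes "g \<in> \<Gamma>"
  shows "poly (f_poly g) (of_nat n) = of_nat (card {f \<in> functions_fixed_by N g. P f \<and> f ` N \<subseteq> {1..n}})"
  unfolding card_bounded_fixed[OF assms]
  by (simp add: f_poly_def poly_sum poly_binomial_poly binomial_gbinomial)

text \<open>The pairs \<open>(i, i + 1)\<close> and \<open>(i, card N - i)\<close>, in the ranges of
  the definition, satisfy the two conditions of \<open>f_vector_le\<close>.\<close>

lemma effectively_flawless_f_poly:
  assumes "\<And>g. g \<in> \<Gamma> \<Longrightarrow> p g = f_poly g"
  shows "effectively_flawless group_\<Gamma> (card N) p"
  unfolding effectively_flawless_def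
  by (rule exI[of _ "\<lambda>i g. of_nat (f_vector i g)"])
    (auto simp: assms f_poly_def intro: f_vector_le class_function_comp[OF class_function_f_vector])

end

section \<open>Compositions and monomials\<close>

text \<open>The usual passage from compositions to subsets, recording where the parts begin, counted
  from 1. This matches the types: blocks of sizes \<alpha> begin at these positions.\<close>

definition partial_sums :: "nat list \<Rightarrow> nat set" where
  "partial_sums \<alpha> = (\<lambda>j. Suc (sum_list (take j \<alpha>))) ` {..<length \<alpha>}"

definition composition_monomial :: "nat list \<Rightarrow> nat list \<Rightarrow> nat \<Rightarrow>\<^sub>0 nat" where
  "composition_monomial js \<alpha> = (\<Sum>j<length \<alpha>. Poly_Mapping.single (js ! j) (\<alpha> ! j))"

lemma sum_list_take_less:
  fixes \<alpha> :: "nat list"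
  assumes "0 \<notin> set \<alpha>" "i < j" "j \<le> length \<alpha>"
  shows "sum_list (take i \<alpha>) < sum_list (take j \<alpha>)"
proof -
  have "take j \<alpha> = take i \<alpha> @ \<alpha> ! i # drop (Suc i) (take j \<alpha>)"
    using assms(2,3) id_take_nth_drop[of i "take j \<alpha>"] by (simp add: min_def)
  then have "sum_list (take j \<alpha>) \<ge> sum_list (take i \<alpha>) + \<alpha> ! i"
    by (metis (no_types, lifting) add.assoc le_add1 sum_list.Cons sum_list_append)
  moreover have "\<alpha> ! i \<noteq> 0"
    using assms by (metis nth_mem less_le_trans)
  ultimately show ?thesis by linarith
qed

lemma card_partial_sums:
  assumes "\<alpha> \<in> compositions"
  shows "card (partial_sums \<alpha>) = length \<alpha>"
proof -
  have "inj_on (\<lambda>j. Suc (sum_list (take j \<alpha>))) {..<length \<alpha>}"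
  proof (rule inj_onI)
    fix i j assume "i \<in> {..<length \<alpha>}" "j \<in> {..<length \<alpha>}" "Suc (sum_list (take i \<alpha>)) = Suc (sum_list (take j \<alpha>))"
    then show "i = j"
      using sum_list_take_less[of \<alpha> i j] sum_list_take_less[of \<alpha> j i] assms
      by (cases i j rule: linorder_cases) (auto simp: compositions_def)
  qed
  then show ?thesis by (simp add: partial_sums_def card_image)
qed

lemma partial_sums_subset:
  assumes "\<alpha> \<in> compositions"
  shows "partial_sums \<alpha> \<subseteq> {1..sum_list \<alpha>}"
  using sum_list_take_less[of \<alpha> _ "length \<alpha>"] assms
  by (auto simp: partial_sums_def compositions_def Suc_le_eq)

text \<open>The starting positions determine every part except the last, which the total
  supplies.\<close>

lemma partial_sums_inj:
  assumes \<alpha>: "\<alpha> \<in> compositions" and \<beta>: "\<beta> \<in> compositions" and len: "length \<alpha> = length \<beta>"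
    and sum: "sum_list \<alpha> = sum_list \<beta>" and eq: "partial_sums \<alpha> = partial_sums \<beta>"
  shows "\<alpha> = \<beta>"
proof -
  define L where "L \<gamma> = map (\<lambda>j. Suc (sum_list (take j \<gamma>))) [0..<length \<gamma>]" for \<gamma>
  have L: "sorted_wrt (<) (L \<gamma>)" "set (L \<gamma>) = partial_sums \<gamma>" if "\<gamma> \<in> compositions" for \<gamma>
    using that sum_list_take_less[of \<gamma>]
    by (auto simp: L_def partial_sums_def compositions_def sorted_wrt_iff_nth_less)
  have "L \<alpha> = L \<beta>"
    using L[OF \<alpha>] L[OF \<beta>] eq by (intro strict_sorted_equal) auto
  then have less: "sum_list (take j \<alpha>) = sum_list (take j \<beta>)" if "j < length \<alpha>" for j
    using that len arg_cong[of "L \<alpha>" "L \<beta>" "\<lambda>l. l ! j"] by (simp add: L_def)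
  have le: "sum_list (take j \<alpha>) = sum_list (take j \<beta>)" if "j \<le> length \<alpha>" for j
    using that less len sum by (cases "j = length \<alpha>") auto
  show ?thesis
  proof (rule nth_equalityI[OF len])
    fix j assume j: "j < length \<alpha>"
    then show "\<alpha> ! j = \<beta> ! j"
      using le[of j] le[of "Suc j"] len by (simp add: take_Suc_conv_app_nth)
  qed
qed

lemma sum_list_concat: "sum_list (concat xss) = sum_list (map sum_list xss)"
  by (induction xss) auto

lemma refined_by_sum_list: "refined_by \<alpha> \<beta> \<Longrightarrow> sum_list \<alpha> = sum_list \<beta>"
  by (auto simp: refined_by_def sum_list_concat)

text \<open>A prefix of \<alpha> has the same sum as the prefix of \<beta> formed by the
  corresponding groups, so every start of a part of \<alpha> is also a start of a part of
  \<beta>.\<close>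

lemma refined_by_partial_sums:
  assumes "refined_by \<alpha> \<beta>" "\<alpha> \<in> compositions"
  shows "partial_sums \<alpha> \<subseteq> partial_sums \<beta>"
proof -
  obtain \<gamma> where \<gamma>: "\<alpha> = map sum_list \<gamma>" "\<beta> = concat \<gamma>"
    using assms(1) by (auto simp: refined_by_def)
  have "Suc (sum_list (take j \<alpha>)) \<in> partial_sums \<beta>" if j: "j < length \<alpha>" for j
  proof -
    let ?k = "length (concat (take j \<gamma>))"
    have j': "j < length \<gamma>" using j \<gamma>(1) by simp
    have "\<beta> = concat (take j \<gamma> @ \<gamma> ! j # drop (Suc j) \<gamma>)"
      unfolding \<gamma>(2) using id_take_nth_drop[OF j'] by simp
    then have \<beta>: "\<beta> = concat (take j \<gamma>) @ \<gamma> ! j @ concat (drop (Suc j) \<gamma>)" by simp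
    \<comment> \<open>An empty group would produce a part 0. Nonemptiness guarantees that a part of
      \<beta> really begins at this position.\<close>
    have "\<gamma> ! j \<noteq> []"
    proof
      assume "\<gamma> ! j = []"
      then have "\<alpha> ! j = 0" using j' \<gamma>(1) by simp
      then show False using assms(2) j nth_mem[OF j] by (simp add: compositions_def)
    qed
    then have "?k < length \<beta>" by (simp add: \<beta>)
    moreover have "sum_list (take ?k \<beta>) = sum_list (take j \<alpha>)"
      unfolding \<beta> \<gamma>(1) by (simp add: take_map sum_list_concat)
    ultimately show ?thesis
      unfolding partial_sums_def by (metis image_eqI lessThan_iff)
  qed
  then show ?thesis by (auto simp: partial_sums_def)
qed

lemma finite_compositions_of: "finite {\<alpha> \<in> compositions. sum_list \<alpha> = n}"
proof (rule finite_subset)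
  show "{\<alpha> \<in> compositions. sum_list \<alpha> = n} \<subseteq> {\<alpha>. set \<alpha> \<subseteq> {..n} \<and> length \<alpha> \<le> n}"
  proof
    fix \<alpha> assume \<alpha>: "\<alpha> \<in> {\<alpha> \<in> compositions. sum_list \<alpha> = n}"
    have "length \<alpha> \<le> sum_list \<alpha>" if "0 \<notin> set \<alpha>" using that by (induction \<alpha>) auto
    then show "\<alpha> \<in> {\<alpha>. set \<alpha> \<subseteq> {..n} \<and> length \<alpha> \<le> n}"
      using \<alpha> member_le_sum_list[of _ \<alpha>] by (auto simp: compositions_def)
  qed
  show "finite {\<alpha>. set \<alpha> \<subseteq> {..n} \<and> length \<alpha> \<le> n}"
    by (rule finite_lists_length_le) simp
qed

section \<open>Monomials, their compositions and the types of functions\<close>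

definition composition_of_monomial :: "(nat \<Rightarrow>\<^sub>0 nat) \<Rightarrow> nat list" where
  "composition_of_monomial m = map (Poly_Mapping.lookup m) (sorted_list_of_set (Poly_Mapping.keys m))"

lemma composition_of_monomial_in_compositions: "composition_of_monomial m \<in> compositions"
  by (auto simp: composition_of_monomial_def compositions_def in_keys_iff)

lemma composition_monomial_keys:
  "composition_monomial (sorted_list_of_set (Poly_Mapping.keys m)) (composition_of_monomial m) = m"
    (is "composition_monomial ?js ?\<alpha> = m")
proof (rule poly_mapping_eqI)
  fix x
  have js: "distinct ?js" "length ?js = length ?\<alpha>" "0 \<notin> set ?\<alpha>"
    using composition_of_monomial_in_compositions[of m]
    by (auto simp: composition_of_monomial_def compositions_def)
  show "Poly_Mapping.lookup (composition_monomial ?js ?\<alpha>) x = Poly_Mapping.lookup m x"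
  proof (cases "x \<in> Poly_Mapping.keys m")
    case True
    then obtain k where k: "k < length ?\<alpha>" "x = ?js ! k"
      using js(2) by (metis finite_keys in_set_conv_nth set_sorted_list_of_set)
    then have "Poly_Mapping.lookup (composition_monomial ?js ?\<alpha>) x = ?\<alpha> ! k"
      using lookup_sum_single_nth[OF js(1,2) k(1)] by (simp add: composition_monomial_def)
    also have "\<dots> = Poly_Mapping.lookup m x"
      using k by (simp add: composition_of_monomial_def)
    finally show ?thesis .
  next
    case False
    then have "x \<notin> Poly_Mapping.keys (composition_monomial ?js ?\<alpha>)"
      using keys_sum_single_nth[OF js] by (simp add: composition_monomial_def)
    then show ?thesis using False by (simp add: in_keys_iff)
  qed
qed

lemma composition_monomial_eq_iff:
  assumes "sorted_wrt (<) js" "length js = length \<alpha>" "\<alpha> \<in> compositions"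
  shows "composition_monomial js \<alpha> = m \<longleftrightarrow>
    js = sorted_list_of_set (Poly_Mapping.keys m) \<and> \<alpha> = composition_of_monomial m"
proof
  assume m: "composition_monomial js \<alpha> = m"
  have d: "distinct js" using assms(1) strict_sorted_iff by blast
  have "Poly_Mapping.keys m = set js"
    using keys_sum_single_nth[OF d assms(2)] assms(3) m by (simp add: composition_monomial_def compositions_def)
  then have js: "js = sorted_list_of_set (Poly_Mapping.keys m)"
    using assms(1) by (intro strict_sorted_equal) auto
  have "\<alpha> = map (Poly_Mapping.lookup m) js"
    using lookup_sum_single_nth[OF d assms(2)] assms(2) m
    by (intro nth_equalityI) (auto simp: composition_monomial_def)
  then show "js = sorted_list_of_set (Poly_Mapping.keys m) \<and> \<alpha> = composition_of_monomial m"
    using js by (simp add: composition_of_monomial_def)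
qed (use composition_monomial_keys in auto)

lemma monomial_qsym_eq:
  assumes "\<alpha> \<in> compositions"
  shows "monomial_qsym \<alpha> m = of_bool (0 \<notin> Poly_Mapping.keys m \<and> \<alpha> = composition_of_monomial m)"
proof -
  let ?js = "sorted_list_of_set (Poly_Mapping.keys m)"
  have len: "length ?js = length (composition_of_monomial m)" by (simp add: composition_of_monomial_def)
  have "{js \<in> {js. length js = length \<alpha> \<and> sorted_wrt (<) js \<and> 0 \<notin> set js}. composition_monomial js \<alpha> = m}
      = (if 0 \<notin> Poly_Mapping.keys m \<and> \<alpha> = composition_of_monomial m then {?js} else {})"
    using composition_monomial_eq_iff[OF _ _ assms, of _ m] len by auto
  then show ?thesis
    unfolding monomial_qsym_def formal_sum_def composition_monomial_def[symmetric] by simp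
qed

lemma M_combination_eq:
  assumes "Poly_Mapping.keys c \<subseteq> compositions"
  shows "M_combination c m =
    (if 0 \<in> Poly_Mapping.keys m then 0 else Poly_Mapping.lookup c (composition_of_monomial m))"
proof -
  have "M_combination c m = (\<Sum>\<alpha>\<in>Poly_Mapping.keys c. Poly_Mapping.lookup c \<alpha> *
      of_bool (0 \<notin> Poly_Mapping.keys m \<and> \<alpha> = composition_of_monomial m))"
    unfolding M_combination_def using assms by (intro sum.cong) (auto simp: monomial_qsym_eq)
  also have "\<dots> = (\<Sum>\<alpha>\<in>Poly_Mapping.keys c. if \<alpha> = composition_of_monomial m
      then (if 0 \<in> Poly_Mapping.keys m then 0 else Poly_Mapping.lookup c \<alpha>) else 0)"
    by (intro sum.cong) auto
  also have "\<dots> = (if 0 \<in> Poly_Mapping.keys m then 0 else Poly_Mapping.lookup c (composition_of_monomial m))"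
    by (simp add: in_keys_iff)
  finally show ?thesis .
qed

lemma lookup_function_monomial:
  assumes "finite N"
  shows "Poly_Mapping.lookup (function_monomial N f) x = card {v\<in>N. f v = x}"
proof -
  have "Poly_Mapping.lookup (function_monomial N f) x = (\<Sum>v\<in>N. if f v = x then 1 else 0)"
    unfolding function_monomial_def lookup_sum
    by (intro sum.cong) (auto simp: lookup_single when_def)
  then show ?thesis using assms by (simp flip: sum.inter_filter)
qed

lemma keys_function_monomial:
  assumes "finite N"
  shows "Poly_Mapping.keys (function_monomial N f) = f ` N"
proof -
  have "card {v\<in>N. f v = x} \<noteq> 0 \<longleftrightarrow> x \<in> f ` N" for x using assms by auto
  then show ?thesis by (auto simp: in_keys_iff lookup_function_monomial[OF assms])
qed

lemma sum_list_composition_of_function_monomial: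
  assumes "finite N"
  shows "sum_list (composition_of_monomial (function_monomial N f)) = card N"
proof -
  have "sum_list (composition_of_monomial (function_monomial N f)) =
      (\<Sum>x\<in>f ` N. card {v\<in>N. f v = x})"
    using assms
    by (simp add: composition_of_monomial_def keys_function_monomial lookup_function_monomial sum_list_distinct_conv_sum_set cong: map_cong)
  also have "\<dots> = (\<Sum>x\<in>f ` N. \<Sum>v\<in>{v\<in>N. f v = x}. 1)" by simp
  also have "\<dots> = (\<Sum>v\<in>N. 1)" using assms by (intro sum.group) auto
  finally show ?thesis by simp
qed

text \<open>This links types to compositions. The elements below the value with index
  \<open>j\<close> in increasing order (counted from 0) are those taking one of the first
  \<open>j\<close> values, and their number is the sum of the first \<open>j\<close>
  exponents.\<close>

lemma partial_sums_function_monomial: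
  assumes "finite N"
  shows "standardize N f ` N = partial_sums (composition_of_monomial (function_monomial N f))"
proof -
  let ?js = "sorted_list_of_set (f ` N)" and ?\<alpha> = "composition_of_monomial (function_monomial N f)"
  have \<alpha>: "?\<alpha> = map (\<lambda>x. card {v\<in>N. f v = x}) ?js"
    using assms by (simp add: composition_of_monomial_def keys_function_monomial lookup_function_monomial)
  have js: "sorted_wrt (<) ?js" "set ?js = f ` N" using assms by auto
  have take: "card {v\<in>N. f v \<in> set (take j ?js)} = sum_list (take j ?\<alpha>)" if "j \<le> length ?js" for j
    using that
  proof (induction j)
    case (Suc j)
    have "{v\<in>N. f v \<in> set (take (Suc j) ?js)} = {v\<in>N. f v \<in> set (take j ?js)} \<union> {v\<in>N. f v = ?js ! j}"
      using Suc.prems by (auto simp: take_Suc_conv_app_nth)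
    moreover have "?js ! j \<notin> set (take j ?js)"
      using Suc.prems distinct_take[of ?js "Suc j"] by (simp add: take_Suc_conv_app_nth)
    ultimately have "card {v\<in>N. f v \<in> set (take (Suc j) ?js)} =
        card {v\<in>N. f v \<in> set (take j ?js)} + card {v\<in>N. f v = ?js ! j}"
      using assms by (simp only:) (rule card_Un_disjoint; auto)
    then show ?case using Suc by (simp add: take_Suc_conv_app_nth \<alpha>)
  qed simp
  have below: "{v\<in>N. f v < ?js ! j} = {v\<in>N. f v \<in> set (take j ?js)}" if j: "j < length ?js" for j
  proof -
    have "f v < ?js ! j \<longleftrightarrow> f v \<in> set (take j ?js)" if v: "v \<in> N" for v
    proof -
      obtain i where i: "i < length ?js" "f v = ?js ! i"
        using v js(2) by (metis imageI in_set_conv_nth)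
      have "?js ! i < ?js ! j \<longleftrightarrow> i < j"
        using sorted_wrt_nth_less[OF js(1), of i j] sorted_wrt_nth_less[OF js(1), of j i] i(1) j
        by (cases i j rule: linorder_cases) auto
      also have "\<dots> \<longleftrightarrow> ?js ! i \<in> set (take j ?js)"
        using i(1) j by (auto simp: in_set_conv_nth nth_eq_iff_index_eq)
      finally show ?thesis using i(2) by simp
    qed
    then show ?thesis by auto
  qed
  have "standardize N f ` N = (\<lambda>x. Suc (card {v\<in>N. f v < x})) ` set ?js"
    unfolding js(2) by (auto simp: standardize_def)
  also have "set ?js = (!) ?js ` {..<length ?js}"
    by (auto simp: set_conv_nth)
  also have "(\<lambda>x. Suc (card {v\<in>N. f v < x})) ` (!) ?js ` {..<length ?js} =
      (\<lambda>j. Suc (sum_list (take j ?\<alpha>))) ` {..<length ?js}"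
    unfolding image_image using below take by (intro image_cong) auto
  finally show ?thesis by (simp add: partial_sums_def \<alpha>)
qed

text \<open>A monomial is given by its variables and its sequence of exponents. The variables fix
  the number of exponents, and with the total known the type then fixes the sequence by
  \<open>partial_sums_inj\<close>.\<close>

lemma function_monomial_eq_iff:
  assumes "finite N" and sum: "sum_list (composition_of_monomial m) = card N"
  shows "function_monomial N f = m \<longleftrightarrow>
    f ` N = Poly_Mapping.keys m \<and> standardize N f ` N = partial_sums (composition_of_monomial m)"
proof
  assume "function_monomial N f = m"
  then show "f ` N = Poly_Mapping.keys m \<and> standardize N f ` N = partial_sums (composition_of_monomial m)"
    using keys_function_monomial[OF assms(1), of f] partial_sums_function_monomial[OF assms(1), of f] by simp
next
  assume f: "f ` N = Poly_Mapping.keys m \<and> standardize N f ` N = partial_sums (composition_of_monomial m)"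
  have keys: "Poly_Mapping.keys (function_monomial N f) = Poly_Mapping.keys m"
    using f keys_function_monomial[OF assms(1)] by simp
  have "composition_of_monomial (function_monomial N f) = composition_of_monomial m"
  proof (rule partial_sums_inj)
    show "length (composition_of_monomial (function_monomial N f)) = length (composition_of_monomial m)"
      by (simp add: composition_of_monomial_def keys)
    show "sum_list (composition_of_monomial (function_monomial N f)) = sum_list (composition_of_monomial m)"
      using sum_list_composition_of_function_monomial[OF assms(1)] sum by simp
    show "partial_sums (composition_of_monomial (function_monomial N f)) = partial_sums (composition_of_monomial m)"
      using f partial_sums_function_monomial[OF assms(1), of f] by simp
  qed (rule composition_of_monomial_in_compositions)+
  then show "function_monomial N f = m"
    using composition_monomial_keys[of "function_monomial N f"] composition_monomial_keys[of m] keys by metis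
qed

section \<open>Expansion into monomial quasisymmetric functions\<close>

context order_family
begin

text \<open>Compositions differing only in the last part have equal \<open>partial_sums\<close>, so
  the total must be imposed separately. It also makes the support finite.\<close>

definition M_coefficients :: "('a \<Rightarrow> 'a) \<Rightarrow> nat list \<Rightarrow>\<^sub>0 complex" where
  "M_coefficients g = Abs_poly_mapping
     (\<lambda>\<alpha>. if \<alpha> \<in> compositions \<and> sum_list \<alpha> = card N then of_nat (fixed_packed (partial_sums \<alpha>) g) else 0)"

lemma lookup_M_coefficients:
  "Poly_Mapping.lookup (M_coefficients g) \<alpha> =
     (if \<alpha> \<in> compositions \<and> sum_list \<alpha> = card N then of_nat (fixed_packed (partial_sums \<alpha>) g) else 0)"
proof -
  have "finite {\<alpha>. (if \<alpha> \<in> compositions \<and> sum_list \<alpha> = card N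
      then of_nat (fixed_packed (partial_sums \<alpha>) g) else 0 :: complex) \<noteq> 0}"
    by (rule finite_subset[OF _ finite_compositions_of[of "card N"]]) auto
  then show ?thesis unfolding M_coefficients_def by (subst Abs_poly_mapping_inverse) auto
qed

lemma keys_M_coefficients: "Poly_Mapping.keys (M_coefficients g) \<subseteq> compositions"
  by (auto simp: in_keys_iff lookup_M_coefficients split: if_splits)

text \<open>Both sides vanish if \<open>m\<close> contains the variable of index 0 or has the wrong
  degree. Otherwise prescribing the monomial means prescribing value set and type, and
  standardization removes the dependence on the value set; this is the quasisymmetry.\<close>

lemma fixed_series_eq_M_combination:
  assumes g: "g \<in> \<Gamma>"
  shows "of_nat (card {f \<in> functions_fixed_by N g. P f \<and> function_monomial N f = m}) =
    M_combination (M_coefficients g) m"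
proof -
  let ?\<alpha> = "composition_of_monomial m" and ?K = "Poly_Mapping.keys m"
  let ?F = "{f \<in> functions_fixed_by N g. P f \<and> function_monomial N f = m}"
  have keys: "f ` N = ?K" if "f \<in> ?F" for f
    using that keys_function_monomial[OF finite_N, of f] by auto
  consider "0 \<in> ?K" | "0 \<notin> ?K" "sum_list ?\<alpha> \<noteq> card N" | "0 \<notin> ?K" "sum_list ?\<alpha> = card N"
    by blast
  then show ?thesis
  proof cases
    case 1
    have none: "?F = {}"
    proof (rule ccontr)
      assume "?F \<noteq> {}"
      then obtain f where f: "f \<in> ?F" by blast
      then have "0 \<in> f ` N" using keys 1 by simp
      then obtain v where v: "v \<in> N" "f v = 0" by auto
      have "f \<in> N \<rightarrow>\<^sub>E {1..}" using f by (simp add: functions_fixed_by_def)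
      from PiE_mem[OF this v(1)] show False using v(2) by simp
    qed
    show ?thesis unfolding none using 1 by (simp add: M_combination_eq[OF keys_M_coefficients])
  next
    case 2
    have none: "?F = {}" using 2(2) sum_list_composition_of_function_monomial[OF finite_N] by blast
    show ?thesis unfolding none using 2 by (simp add: M_combination_eq[OF keys_M_coefficients] lookup_M_coefficients)
  next
    case 3
    have card: "card ?K = card (partial_sums ?\<alpha>)"
      using card_partial_sums[OF composition_of_monomial_in_compositions, of m]
      by (simp add: composition_of_monomial_def)
    have "?F = {f \<in> functions_fixed_by N g. P f \<and> f ` N = ?K \<and> standardize N f ` N = partial_sums ?\<alpha>}"
      using function_monomial_eq_iff[OF finite_N 3(2)] by auto
    also have "card \<dots> = card {r \<in> standardized N. P r \<and> act g r = r \<and> card (r ` N) = card ?K \<and> r ` N = partial_sums ?\<alpha>}"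
      using 3(1) by (intro card_fixed_eq_card_standardized[OF g]) (auto simp: Suc_le_eq intro: gr0I)
    also have "{r \<in> standardized N. P r \<and> act g r = r \<and> card (r ` N) = card ?K \<and> r ` N = partial_sums ?\<alpha>}
        = {r \<in> packed (partial_sums ?\<alpha>). act g r = r}"
      using card by (auto simp: packed_def)
    finally have "card ?F = fixed_packed (partial_sums ?\<alpha>) g" unfolding fixed_packed_def .
    then show ?thesis
      using 3 composition_of_monomial_in_compositions[of m]
      by (simp add: M_combination_eq[OF keys_M_coefficients] lookup_M_coefficients)
  qed
qed

text \<open>Refinement preserves the total. Either both coefficients vanish, or they are the
  permutation characters of two nested types.\<close>

lemma M_increasing_fixed_series:
  assumes "\<And>g m. g \<in> \<Gamma> \<Longrightarrow>
    F g m = of_nat (card {f \<in> functions_fixed_by N g. P f \<and> function_monomial N f = m})"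
  shows "M_increasing group_\<Gamma> F"
proof -
  have F: "F g = M_combination (M_coefficients g)" if "g \<in> \<Gamma>" for g
    using assms[OF that] fixed_series_eq_M_combination[OF that] by (intro ext) simp
  have "M_coefficients (h \<otimes>\<^bsub>group_\<Gamma>\<^esub> g \<otimes>\<^bsub>group_\<Gamma>\<^esub> inv\<^bsub>group_\<Gamma>\<^esub> h) = M_coefficients g"
    if "g \<in> carrier group_\<Gamma>" "h \<in> carrier group_\<Gamma>" for g h
    using class_function_fixed_packed that
    by (intro poly_mapping_eqI) (simp add: lookup_M_coefficients class_function_def)
  moreover have "h \<otimes>\<^bsub>group_\<Gamma>\<^esub> g \<otimes>\<^bsub>group_\<Gamma>\<^esub> inv\<^bsub>group_\<Gamma>\<^esub> h \<in> carrier group_\<Gamma>"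
    if "g \<in> carrier group_\<Gamma>" "h \<in> carrier group_\<Gamma>" for g h
    using that by (intro monoid.m_closed group.inv_closed group.is_monoid group_group_\<Gamma>)
  ultimately have cls: "class_function group_\<Gamma> F"
    unfolding class_function_def using F by simp
  have "effective_character group_\<Gamma> (\<lambda>g. M_coeff \<beta> (F g) - M_coeff \<alpha> (F g))"
    if \<alpha>\<beta>: "\<alpha> \<in> compositions" "\<beta> \<in> compositions" "refined_by \<alpha> \<beta>" for \<alpha> \<beta>
  proof -
    have M: "M_coeff \<gamma> (F g) = (if \<gamma> \<in> compositions \<and> sum_list \<gamma> = card N then of_nat (fixed_packed (partial_sums \<gamma>) g) else 0)"
      if "g \<in> carrier group_\<Gamma>" for g \<gamma>
      using that F M_coeff_M_combination[OF keys_M_coefficients] by (simp add: lookup_M_coefficients)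
    have eq: "sum_list \<alpha> = sum_list \<beta>" by (rule refined_by_sum_list[OF \<alpha>\<beta>(3)])
    show ?thesis
    proof (cases "sum_list \<beta> = card N")
      case True
      have "effective_character group_\<Gamma>
          (\<lambda>g. of_nat (fixed_packed (partial_sums \<beta>) g) - of_nat (fixed_packed (partial_sums \<alpha>) g))"
        using fixed_packed_le[OF refined_by_partial_sums[OF \<alpha>\<beta>(3,1)]] partial_sums_subset[OF \<alpha>\<beta>(2)] True
        by (simp add: character_le_def)
      then show ?thesis
        by (rule effective_character_cong) (use True eq \<alpha>\<beta> M in simp)
    next
      case False
      then show ?thesis
        using eq M by (intro effective_character_cong[OF effective_character_zero]) simp
    qed
  qed
  moreover have "\<forall>g\<in>carrier group_\<Gamma>. F g \<in> QSym"
    using F keys_M_coefficients by (auto simp: QSym_def)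
  ultimately show ?thesis
    unfolding M_increasing_def using cls by blast
qed

end

section \<open>Double posets and digraphs\<close>

text \<open>Provides uniqueness for the descriptions \<open>Omega_poly\<close> and
  \<open>chi_poly\<close>. The generality covers the second, whose coefficients are polynomials in
  \<open>t\<close>.\<close>

lemma poly_eqI_pos_nat:
  fixes p q :: "'c :: {idom, ring_char_0} poly"
  assumes "\<And>n :: nat. 0 < n \<Longrightarrow> poly p (of_nat n) = poly q (of_nat n)"
  shows "p = q"
proof (rule ccontr)
  assume "p \<noteq> q"
  then have "finite {x. poly (p - q) x = 0}" by (intro poly_roots_finite) simp
  moreover have "of_nat ` {0<..} \<subseteq> {x. poly (p - q) x = 0}" using assms by auto
  ultimately have "finite (of_nat ` {0 :: nat<..} :: 'c set)" by (rule finite_subset[rotated])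
  then have "finite {0 :: nat<..}" by (rule finite_imageD) simp
  then show False by (simp add: infinite_Ioi)
qed

lemma poly_map_poly_const:
  fixes q :: "'c :: comm_ring_1 poly"
  shows "poly (map_poly (\<lambda>c. [:c:]) q) (of_nat n) = [:poly q (of_nat n):]"
  by (induction q) (auto simp: map_poly_pCons of_nat_poly)

text \<open>The function \<open>c\<close> bundles the preserved data: a pair of truth values for a
  double poset, one truth value for a digraph.\<close>

lemma subgroup_preserving:
  "subgroup {g \<in> Bij N. \<forall>i\<in>N. \<forall>j\<in>N. c (g i) (g j) = c i j} (BijGroup N)" (is "subgroup ?A _")
proof (rule group.subgroupI[OF group_BijGroup])
  show "?A \<subseteq> carrier (BijGroup N)" by (auto simp: BijGroup_def)
  have "(\<lambda>x\<in>N. x) \<in> ?A" using id_Bij[of N] by auto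
  then show "?A \<noteq> {}" by blast
next
  fix g assume g: "g \<in> ?A"
  then have bij: "bij_betw g N N" "g \<in> Bij N" by (auto simp: Bij_def)
  have inv_eq: "inv\<^bsub>BijGroup N\<^esub> g = (\<lambda>x\<in>N. inv_into N g x)" by (rule inv_BijGroup[OF bij(2)])
  have "c (inv_into N g i) (inv_into N g j) = c i j" if "i \<in> N" "j \<in> N" for i j
  proof -
    have inv: "inv_into N g x \<in> N" "g (inv_into N g x) = x" if "x \<in> N" for x
      using that inv_into_into[of x g N] f_inv_into_f[of x g N] bij_betw_imp_surj_on[OF bij(1)] by auto
    have "c (g x) (g y) = c x y" if "x \<in> N" "y \<in> N" for x y using g that by simp
    from this[OF inv(1)[OF that(1)] inv(1)[OF that(2)]] show ?thesis
      unfolding inv(2)[OF that(1)] inv(2)[OF that(2)] by simp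
  qed
  then show "inv\<^bsub>BijGroup N\<^esub> g \<in> ?A"
    unfolding inv_eq using restrict_inv_into_Bij[OF bij(2)] by simp
next
  fix g h assume gh: "g \<in> ?A" "h \<in> ?A"
  then have "h i \<in> N" if "i \<in> N" for i using that by (auto simp: Bij_def bij_betw_def)
  then show "g \<otimes>\<^bsub>BijGroup N\<^esub> h \<in> ?A"
    using gh compose_Bij[of g N h] by (auto simp: BijGroup_def compose_def)
qed

lemma ball_bij_betw:
  assumes "bij_betw g N N"
  shows "(\<forall>x\<in>N. Q (g x)) \<longleftrightarrow> (\<forall>x\<in>N. Q x)"
  using bij_betw_imp_surj_on[OF assms] by (metis imageE imageI)

lemma order_family_D_partition:
  assumes "finite N" "double_poset N r1 r2" "subgroup \<GG> (double_poset_Aut N r1 r2)"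
  shows "order_family N \<GG> (D_partition N r1 r2)"
proof (rule order_family.intro)
  let ?A = "{g \<in> Bij N. \<forall>i\<in>N. \<forall>j\<in>N.
    ((g i, g j) \<in> r1 \<longleftrightarrow> (i, j) \<in> r1) \<and> ((g i, g j) \<in> r2 \<longleftrightarrow> (i, j) \<in> r2)}"
  have "subgroup ?A (BijGroup N)"
    using subgroup_preserving[of N "\<lambda>i j. ((i, j) \<in> r1, (i, j) \<in> r2)"] by simp
  then show "subgroup \<GG> (BijGroup N)"
    using group.incl_subgroup[OF group_BijGroup _ assms(3)[unfolded double_poset_Aut_def]] by simp
  show "D_partition N r1 r2 f = D_partition N r1 r2 f'" if "same_order N f f'" for f f'
    using same_order_le[OF that] that by (simp add: D_partition_def same_order_def)
  show "D_partition N r1 r2 (\<lambda>v. f (g v)) = D_partition N r1 r2 f" if "g \<in> \<GG>" for f g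
  proof -
    have gA: "g \<in> ?A"
      using subgroup.subset[OF assms(3)] that by (auto simp: double_poset_Aut_def)
    then have bij: "bij_betw g N N" by (simp add: Bij_def)
    let ?Q = "\<lambda>i j. ((i, j) \<in> r1 \<longrightarrow> f i \<le> f j) \<and> ((i, j) \<in> r1 \<and> i \<noteq> j \<and> (j, i) \<in> r2 \<longrightarrow> f i < f j)"
    have "D_partition N r1 r2 f \<longleftrightarrow> (\<forall>i\<in>N. \<forall>j\<in>N. ?Q i j)"
      unfolding D_partition_def by blast
    also have "\<dots> \<longleftrightarrow> (\<forall>i\<in>N. \<forall>j\<in>N. ?Q i (g j))"
      by (intro ball_cong refl ball_bij_betw[OF bij, symmetric])
    also have "\<dots> \<longleftrightarrow> (\<forall>i\<in>N. \<forall>j\<in>N. ?Q (g i) (g j))"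
      by (rule ball_bij_betw[OF bij, of "\<lambda>i. \<forall>j\<in>N. ?Q i (g j)", symmetric])
    also have "\<dots> \<longleftrightarrow> D_partition N r1 r2 (\<lambda>v. f (g v))"
      using gA inj_on_eq_iff[OF bij_betw_imp_inj_on[OF bij]] unfolding D_partition_def by auto
    finally show ?thesis by simp
  qed
  fix f assume f: "D_partition N r1 r2 f"
  have r1: "trans r1" "antisym r1"
    using assms(2) by (auto simp: double_poset_def partial_order_on_def preorder_on_def)
  \<comment> \<open>Elements are sorted by \<open>f\<close>, and ties are broken by the first order.
    Splitting a fibre along this order keeps \<open>h\<close> weakly increasing for
    \<open>r1\<close>, while strict inequalities required of \<open>f\<close> survive because
    \<open>h\<close> separates what \<open>f\<close> separates.\<close>
  define lt where "lt u v \<longleftrightarrow> f u < f v \<or> f u = f v \<and> (u, v) \<in> r1 \<and> u \<noteq> v" for u v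
  obtain p :: "'a \<Rightarrow> nat" where p: "bij_betw p N {..<card N}"
    and mono: "\<forall>u\<in>N. \<forall>v\<in>N. lt u v \<longrightarrow> p u < p v"
  proof -
    have "lt u w" if "lt u v" "lt v w" for u v w
      using that r1 unfolding lt_def by (auto dest: transD antisymD)
    then show thesis
      using linear_extension[OF assms(1), of lt] that by (auto simp: lt_def)
  qed
  have "D_partition N r1 r2 h"
    if h: "\<forall>u\<in>N. \<forall>v\<in>N. (p u \<le> p v \<longrightarrow> h u \<le> h v) \<and> (f u < f v \<longrightarrow> h u < h v)" for h
    unfolding D_partition_def
  proof (intro conjI ballI impI)
    fix i j assume ij: "i \<in> N" "j \<in> N"
    show "h i \<le> h j" if r: "(i, j) \<in> r1"
    proof (cases "i = j")
      case False
      have "f i \<le> f j" using f ij r by (auto simp: D_partition_def)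
      then have "lt i j" using r False by (auto simp: lt_def)
      then show ?thesis using mono h ij by (meson less_imp_le)
    qed simp
    show "h i < h j" if "(i, j) \<in> r1 - Id \<and> (j, i) \<in> r2 - Id"
      using f h ij that unfolding D_partition_def by blast
  qed
  then show "\<exists>p. bij_betw p N {..<card N} \<and> (\<forall>u\<in>N. \<forall>v\<in>N. f u < f v \<longrightarrow> p u < p v) \<and>
      (\<forall>h. (\<forall>u\<in>N. \<forall>v\<in>N. (p u \<le> p v \<longrightarrow> h u \<le> h v) \<and> (f u < f v \<longrightarrow> h u < h v)) \<longrightarrow> D_partition N r1 r2 h)"
    using p mono by (intro exI[of _ p]) (auto simp: lt_def)
qed (fact assms(1))

lemma Omega_M_increasing_flawless:
  assumes "finite N" "double_poset N r1 r2" "subgroup \<GG> (double_poset_Aut N r1 r2)"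
  shows "M_increasing ((double_poset_Aut N r1 r2)\<lparr>carrier := \<GG>\<rparr>) (Omega_series N r1 r2)"
    and "effectively_flawless ((double_poset_Aut N r1 r2)\<lparr>carrier := \<GG>\<rparr>) (card N) (Omega_poly N r1 r2)"
proof -
  interpret order_family N \<GG> "D_partition N r1 r2"
    by (rule order_family_D_partition[OF assms])
  have G: "(double_poset_Aut N r1 r2)\<lparr>carrier := \<GG>\<rparr> = group_\<Gamma>"
    by (simp add: double_poset_Aut_def)
  show "M_increasing ((double_poset_Aut N r1 r2)\<lparr>carrier := \<GG>\<rparr>) (Omega_series N r1 r2)"
    unfolding G
    by (rule M_increasing_fixed_series) (simp add: Omega_series_def formal_sum_def conj_assoc)
  have "Omega_poly N r1 r2 g = f_poly g" if g: "g \<in> \<GG>" for g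
    unfolding Omega_poly_def
  proof (rule the_equality)
    show "\<forall>n::nat. 0 < n \<longrightarrow> poly (f_poly g) (of_nat n) =
        of_nat (card {f \<in> functions_fixed_by N g. D_partition N r1 r2 f \<and> f ` N \<subseteq> {1..n}})"
      using poly_f_poly[OF g] by simp
    show "p = f_poly g" if "\<forall>n::nat. 0 < n \<longrightarrow> poly p (of_nat n) =
        of_nat (card {f \<in> functions_fixed_by N g. D_partition N r1 r2 f \<and> f ` N \<subseteq> {1..n}})" for p
      by (rule poly_eqI_pos_nat) (use that poly_f_poly[OF g] in simp)
  qed
  then show "effectively_flawless ((double_poset_Aut N r1 r2)\<lparr>carrier := \<GG>\<rparr>) (card N) (Omega_poly N r1 r2)"
    unfolding G by (rule effectively_flawless_f_poly)
qed

lemma order_family_coloring: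
  assumes "finite N" "digraph N E" "subgroup \<HH> (digraph_Aut N E)"
  shows "order_family N \<HH> (\<lambda>f. coloring E f \<and> asc E f = k)"
proof (rule order_family.intro)
  let ?A = "{g \<in> Bij N. \<forall>u\<in>N. \<forall>v\<in>N. (g u, g v) \<in> E \<longleftrightarrow> (u, v) \<in> E}"
  have EN: "E \<subseteq> N \<times> N" using assms(2) by (simp add: digraph_def)
  have "subgroup ?A (BijGroup N)"
    using subgroup_preserving[of N "\<lambda>i j. (i, j) \<in> E"] by simp
  then show "subgroup \<HH> (BijGroup N)"
    using group.incl_subgroup[OF group_BijGroup _ assms(3)[unfolded digraph_Aut_def]] by simp
  have cong: "(coloring E f \<and> asc E f = k) = (coloring E f' \<and> asc E f' = k)"
    if "\<And>u v. (u, v) \<in> E \<Longrightarrow> (f u < f v \<longleftrightarrow> f' u < f' v) \<and> (f v < f u \<longleftrightarrow> f' v < f' u)" for f f' :: "'a \<Rightarrow> nat"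
  proof -
    have "{(u, v) \<in> E. f u > f v} = {(u, v) \<in> E. f' u > f' v}" using that by auto
    moreover have "coloring E f \<longleftrightarrow> coloring E f'"
      unfolding coloring_def using that by (auto simp: nat_neq_iff)
    ultimately show ?thesis by (simp add: asc_def)
  qed
  show "(coloring E f \<and> asc E f = k) = (coloring E f' \<and> asc E f' = k)" if "same_order N f f'" for f f'
    by (rule cong) (use that EN in \<open>auto simp: same_order_def\<close>)
  show "(coloring E (\<lambda>v. f (g v)) \<and> asc E (\<lambda>v. f (g v)) = k) = (coloring E f \<and> asc E f = k)"
    if "g \<in> \<HH>" for f g
  proof -
    have gA: "g \<in> ?A"
      using subgroup.subset[OF assms(3)] that by (auto simp: digraph_Aut_def)
    then have bij: "bij_betw g N N" by (simp add: Bij_def)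
    have "bij_betw (map_prod g g) {e \<in> N \<times> N. e \<in> E} {e \<in> N \<times> N. e \<in> E}"
      by (rule bij_betw_Collect[OF bij_betw_map_prod[OF bij bij]]) (use gA in auto)
    then have bijE: "bij_betw (map_prod g g) E E"
      using EN by (simp add: Int_absorb1 flip: Int_def)
    have "coloring E f \<longleftrightarrow> coloring E (\<lambda>v. f (g v))"
      using ball_bij_betw[OF bijE, of "\<lambda>(u, v). f u \<noteq> f v"] by (auto simp: coloring_def)
    moreover have "asc E (\<lambda>v. f (g v)) = asc E f"
    proof -
      have "bij_betw (map_prod g g) {e \<in> E. f (g (fst e)) > f (g (snd e))} {e \<in> E. f (fst e) > f (snd e)}"
        by (rule bij_betw_Collect[OF bijE]) auto
      from bij_betw_same_card[OF this] show ?thesis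
        by (simp add: asc_def case_prod_unfold)
    qed
    ultimately show ?thesis by simp
  qed
  fix f assume f: "coloring E f \<and> asc E f = k"
  \<comment> \<open>Ties may be broken arbitrarily here: the ends of an edge have different colors
    under \<open>f\<close>, and \<open>h\<close> keeps every strict comparison, so coloring and
    ascents are unchanged.\<close>
  obtain p :: "'a \<Rightarrow> nat" where p: "bij_betw p N {..<card N}"
    and mono: "\<forall>u\<in>N. \<forall>v\<in>N. f u < f v \<longrightarrow> p u < p v"
    using linear_extension[OF assms(1), of "\<lambda>u v. f u < f v"] by auto
  have "coloring E h \<and> asc E h = k"
    if h: "\<forall>u\<in>N. \<forall>v\<in>N. (p u \<le> p v \<longrightarrow> h u \<le> h v) \<and> (f u < f v \<longrightarrow> h u < h v)" for h
  proof -
    have "(h u < h v \<longleftrightarrow> f u < f v) \<and> (h v < h u \<longleftrightarrow> f v < f u)" if e: "(u, v) \<in> E" for u v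
    proof -
      have uv: "u \<in> N" "v \<in> N" using e EN by auto
      have "f u \<noteq> f v" using f e by (auto simp: coloring_def)
      moreover have "f u < f v \<longrightarrow> h u < h v" "f v < f u \<longrightarrow> h v < h u" using h uv by auto
      ultimately show ?thesis by linarith
    qed
    then show ?thesis using cong[of h f] f by simp
  qed
  then show "\<exists>p. bij_betw p N {..<card N} \<and> (\<forall>u\<in>N. \<forall>v\<in>N. f u < f v \<longrightarrow> p u < p v) \<and>
      (\<forall>h. (\<forall>u\<in>N. \<forall>v\<in>N. (p u \<le> p v \<longrightarrow> h u \<le> h v) \<and> (f u < f v \<longrightarrow> h u < h v)) \<longrightarrow> coloring E h \<and> asc E h = k)"
    using p mono by (intro exI[of _ p]) simp
qed (fact assms(1))

lemma coeff_sum_monom_one: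
  assumes "finite A"
  shows "Polynomial.coeff (\<Sum>a\<in>A. Polynomial.monom 1 (e a)) k = (of_nat (card {a\<in>A. e a = k}) :: complex)"
  using assms by (simp add: Polynomial.coeff_sum flip: sum.inter_filter)

lemma sum_monom_by_exponent:
  assumes "finite A" "\<And>a. a \<in> A \<Longrightarrow> e a \<le> K"
  shows "(\<Sum>a\<in>A. Polynomial.monom 1 (e a)) =
    (\<Sum>k\<le>K. Polynomial.monom 1 k * [:of_nat (card {a\<in>A. e a = k}) :: complex:])"
proof (rule poly_eqI)
  fix k
  have "Polynomial.coeff (\<Sum>k\<le>K. Polynomial.monom 1 k * [:of_nat (card {a\<in>A. e a = k}) :: complex:]) k
      = (\<Sum>l\<le>K. if l = k then of_nat (card {a\<in>A. e a = l}) else 0)"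
    by (simp add: Polynomial.coeff_sum mult.commute smult_monom)
  also have "\<dots> = of_nat (card {a\<in>A. e a = k})"
  proof (cases "k \<le> K")
    case False
    then have none: "{a\<in>A. e a = k} = {}" using assms(2) by auto
    show ?thesis unfolding none using False by auto
  qed simp
  finally show "Polynomial.coeff (\<Sum>a\<in>A. Polynomial.monom 1 (e a)) k =
      Polynomial.coeff (\<Sum>k\<le>K. Polynomial.monom 1 k * [:of_nat (card {a\<in>A. e a = k}) :: complex:]) k"
    using coeff_sum_monom_one[OF assms(1)] by metis
qed

lemma chi_M_increasing_flawless:
  assumes "finite N" "digraph N E" "subgroup \<HH> (digraph_Aut N E)"
  shows "M_increasing ((digraph_Aut N E)\<lparr>carrier := \<HH>\<rparr>) (\<lambda>g. t_coeff_series k (chi_series N E g))"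
    and "effectively_flawless ((digraph_Aut N E)\<lparr>carrier := \<HH>\<rparr>) (card N) (\<lambda>g. t_coeff_poly k (chi_poly N E g))"
proof -
  \<comment> \<open>All numbers of ascents are needed at once, because \<open>chi_poly\<close>
    collects them in a single polynomial over the polynomials in \<open>t\<close>.\<close>
  interpret F: order_family N \<HH> "\<lambda>f. coloring E f \<and> asc E f = l" for l
    by (rule order_family_coloring[OF assms])
  have G: "(digraph_Aut N E)\<lparr>carrier := \<HH>\<rparr> = F.group_\<Gamma>"
    by (simp add: digraph_Aut_def)
  have fin: "finite {f \<in> functions_fixed_by N g. Q f \<and> f ` N \<subseteq> S}" if "finite S" for g Q S
  proof (rule finite_subset)
    show "{f \<in> functions_fixed_by N g. Q f \<and> f ` N \<subseteq> S} \<subseteq> N \<rightarrow>\<^sub>E S"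
      by (auto simp: functions_fixed_by_def PiE_def Pi_def)
  qed (use assms(1) that in \<open>simp add: finite_PiE\<close>)
  show "M_increasing ((digraph_Aut N E)\<lparr>carrier := \<HH>\<rparr>) (\<lambda>g. t_coeff_series k (chi_series N E g))"
    unfolding G
  proof (rule F.M_increasing_fixed_series)
    fix g m
    let ?S = "{f \<in> {f \<in> functions_fixed_by N g. coloring E f}. function_monomial N f = m}"
    \<comment> \<open>All values of such an \<open>f\<close> are variables of \<open>m\<close>; the
      sum is thus finite and the coefficient of \<open>t\<close> to the power \<open>k\<close> can
      be taken termwise.\<close>
    have "finite ?S"
    proof (rule finite_subset)
      show "?S \<subseteq> {f \<in> functions_fixed_by N g. True \<and> f ` N \<subseteq> Poly_Mapping.keys m}"
        using keys_function_monomial[OF assms(1)] by auto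
    qed (rule fin, simp)
    then show "t_coeff_series k (chi_series N E g) m =
        of_nat (card {f \<in> functions_fixed_by N g. (coloring E f \<and> asc E f = k) \<and> function_monomial N f = m})"
      unfolding t_coeff_series_def chi_series_def formal_sum_def
      by (subst coeff_sum_monom_one) (auto intro!: arg_cong[of _ _ card])
  qed
  have finE: "finite E" using assms(1,2) by (auto simp: digraph_def intro: finite_subset)
  have asc_le: "asc E f \<le> card E" for f
    unfolding asc_def using finE by (intro card_mono) auto
  have "t_coeff_poly k (chi_poly N E g) = F.f_poly k g" if g: "g \<in> \<HH>" for g
  proof -
    \<comment> \<open>The candidate for \<open>chi_poly\<close>: the sum over \<open>l\<close> of
      \<open>t\<close> to the power \<open>l\<close> times the polynomial for \<open>l\<close>
      ascents. Its coefficients are lifted to constants in \<open>t\<close>.\<close>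
    define p where "p = (\<Sum>l\<le>card E. Polynomial.smult (Polynomial.monom 1 l) (map_poly (\<lambda>c. [:c:]) (F.f_poly l g)))"
    have p: "poly p (of_nat n) =
        (\<Sum>f\<in>{f \<in> functions_fixed_by N g. coloring E f \<and> f ` N \<subseteq> {1..n}}. Polynomial.monom 1 (asc E f))" for n
    proof -
      let ?C = "{f \<in> functions_fixed_by N g. coloring E f \<and> f ` N \<subseteq> {1..n}}"
      have "poly p (of_nat n) = (\<Sum>l\<le>card E. Polynomial.monom 1 l * [:of_nat (card {f\<in>?C. asc E f = l}):])"
        unfolding p_def poly_sum
      proof (intro sum.cong refl)
        fix l
        have "{f\<in>?C. asc E f = l} = {f \<in> functions_fixed_by N g. (coloring E f \<and> asc E f = l) \<and> f ` N \<subseteq> {1..n}}"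
          by auto
        then show "poly (Polynomial.smult (Polynomial.monom 1 l) (map_poly (\<lambda>c. [:c:]) (F.f_poly l g))) (of_nat n)
            = Polynomial.monom 1 l * [:of_nat (card {f\<in>?C. asc E f = l}):]"
          by (simp only: poly_smult poly_map_poly_const F.poly_f_poly[OF g])
      qed
      also have "\<dots> = (\<Sum>f\<in>?C. Polynomial.monom 1 (asc E f))"
        by (rule sum_monom_by_exponent[symmetric]) (use fin asc_le in auto)
      finally show ?thesis .
    qed
    have chi: "chi_poly N E g = p"
      unfolding chi_poly_def
    proof (rule the_equality)
      fix q :: "complex poly poly"
      assume "\<forall>n::nat. 0 < n \<longrightarrow> poly q (of_nat n) =
        (\<Sum>f\<in>{f \<in> functions_fixed_by N g. coloring E f \<and> f ` N \<subseteq> {1..n}}. Polynomial.monom 1 (asc E f))"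
      then show "q = p" by (intro poly_eqI_pos_nat) (simp add: p)
    qed (simp add: p)
    \<comment> \<open>The candidate stops at \<open>card E\<close>; for larger \<open>k\<close> no
      coloring has \<open>k\<close> ascents, and both sides are zero.\<close>
    have zero: "F.f_poly k g = 0" if "card E < k"
    proof (rule poly_eqI_pos_nat)
      fix n :: nat
      have none: "{f \<in> functions_fixed_by N g. (coloring E f \<and> asc E f = k) \<and> f ` N \<subseteq> {1..n}} = {}"
        using asc_le that by (auto simp: not_le[symmetric])
      show "poly (F.f_poly k g) (of_nat n) = poly 0 (of_nat n)"
        unfolding F.poly_f_poly[OF g] none by simp
    qed
    show ?thesis
    proof (rule poly_eqI)
      fix i
      have "Polynomial.coeff (t_coeff_poly k p) i = Polynomial.coeff (Polynomial.coeff p i) k"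
        by (simp add: t_coeff_poly_def coeff_map_poly)
      also have "Polynomial.coeff p i = (\<Sum>l\<le>card E. Polynomial.monom (Polynomial.coeff (F.f_poly l g) i) l)"
        by (simp add: p_def Polynomial.coeff_sum coeff_map_poly mult.commute smult_monom)
      also have "Polynomial.coeff \<dots> k = Polynomial.coeff (F.f_poly k g) i"
        using zero by (cases "k \<le> card E") (auto simp: Polynomial.coeff_sum)
      finally show "Polynomial.coeff (t_coeff_poly k (chi_poly N E g)) i = Polynomial.coeff (F.f_poly k g) i"
        unfolding chi .
    qed
  qed
  then show "effectively_flawless ((digraph_Aut N E)\<lparr>carrier := \<HH>\<rparr>) (card N) (\<lambda>g. t_coeff_poly k (chi_poly N E g))"
    unfolding G by (rule F.effectively_flawless_f_poly)
qed

theorem theorem6p2: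
  fixes N :: "'a set"
  assumes "finite N"
  shows
    "(\<forall>r1 r2 \<GG>.
        double_poset N r1 r2 \<and> subgroup \<GG> (double_poset_Aut N r1 r2) \<longrightarrow>
        M_increasing ((double_poset_Aut N r1 r2)\<lparr>carrier := \<GG>\<rparr>) (Omega_series N r1 r2) \<and>
        effectively_flawless ((double_poset_Aut N r1 r2)\<lparr>carrier := \<GG>\<rparr>) (card N)
          (Omega_poly N r1 r2)) \<and>
     (\<forall>E \<HH>.
        digraph N E \<and> subgroup \<HH> (digraph_Aut N E) \<longrightarrow>
        (\<forall>k.
          M_increasing ((digraph_Aut N E)\<lparr>carrier := \<HH>\<rparr>)
            (\<lambda>g. t_coeff_series k (chi_series N E g)) \<and>
          effectively_flawless ((digraph_Aut N E)\<lparr>carrier := \<HH>\<rparr>) (card N)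
            (\<lambda>g. t_coeff_poly k (chi_poly N E g))))"
  using Omega_M_increasing_flawless[OF assms] chi_M_increasing_flawless[OF assms] by blast

end
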